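(* There is a mapping $f\colon[-2,2]^2\to[-2,2]^2$ which is the identity on the boundary of $[-2,2]^2$, belongs to $W^{1,p}([-2,2]^2,[-2,2]^2)$ for every $p<2$, and satisfies the $(INV)$ condition with respect to cubes, but such that for the cubes $Q=[-1,1]^2$ and $Q_1=[-\tfrac12,0]\times[\tfrac12,1]$ we have $$Q_1\subseteq Q,\qquad f(Q_1)\subseteq f(\partial Q),\qquad\text{but } im_T(f,Q_1)\text{ is not a subset of } im_T(f,Q).$$ Moreover, $\deg(f,Q_1,y)=-1$ for every $y\in im_T(f,Q_1)$, and the same conclusion holds for any small $t>0$ with $Q$ and $Q_1$ replaced by the cubes $[-1-t,1+t]^2$ and $[-\tfrac12+t,0-t]\times[\tfrac12+t,1-t]$, respectively.
   Context: Cubes are squares in $\mathbb{R}^2$ with sides parallel to the coordinate axes. For a cube $R$ and $f$ continuous on $\partial R$, $\deg(f,R,y)$ is the Brouwer degree of $f|_{\partial R}$ at $y\notin f(\partial R)$, and $im_T(f,R):=\{y\in\mathbb{R}^2\setminus f(\partial R):\deg(f,R,y)\neq0\}$. A map $f\colon\Omega\to\mathbb{R}^2$ satisfies $(INV)$ for a cube $R\subset\subset\Omega$ if $f$ is continuous on $\partial R$, $f(x)\in im_T(f,R)\cup f(\partial R)$ for a.e. $x\in R$, and $f(x)\notin im_T(f,R)$ for a.e. $x\in\Omega\setminus R$. It satisfies the $(INV)$ condition with respect to cubes if for every $a\in\Omega$ there is $r_a>0$ such that for $\mathcal{H}^1$-a.e. $r\in(0,r_a)$ it satisfies $(INV)$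 for the cube centered at $a$ with sidelength $2r$. The map $f$ is allowed to be undefined (or defined arbitrarily) at finitely many points (centers of cavitation), which are disregarded in $f(Q_1)$. *)

theory Defs
  imports "HOL-Analysis.Analysis" "HOL-Homology.Homology"
begin

section \<open>Sobolev spaces\<close>

primrec Ck :: "nat \<Rightarrow> ('a::euclidean_space \<Rightarrow> real) \<Rightarrow> bool" where
  "Ck 0 \<phi> = continuous_on UNIV \<phi>"
| "Ck (Suc k) \<phi> =
     ((\<forall>x. \<phi> differentiable at x) \<and> (\<forall>b\<in>Basis. Ck k (\<lambda>x. frechet_derivative \<phi> (at x) b)))"

definition test_function :: "'a::euclidean_space set \<Rightarrow> ('a \<Rightarrow> real) \<Rightarrow> bool" where
  "test_function \<Omega> \<phi> \<longleftrightarrow>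
     (\<forall>k. Ck k \<phi>) \<and> (\<exists>K. compact K \<and> K \<subseteq> \<Omega> \<and> (\<forall>x. x \<notin> K \<longrightarrow> \<phi> x = 0))"

definition weak_partial ::
  "'a::euclidean_space set \<Rightarrow> 'a \<Rightarrow> ('a \<Rightarrow> 'b::euclidean_space) \<Rightarrow> ('a \<Rightarrow> 'b) \<Rightarrow> bool" where
  "weak_partial \<Omega> b u v \<longleftrightarrow>
     (\<forall>\<phi>. test_function \<Omega> \<phi> \<longrightarrow>
        (LINT x|lebesgue_on \<Omega>. frechet_derivative \<phi> (at x) b *\<^sub>R u x) =
        - (LINT x|lebesgue_on \<Omega>. \<phi> x *\<^sub>R v x))"

definition in_Lp :: "real \<Rightarrow> 'a::euclidean_space set \<Rightarrow> ('a \<Rightarrow> 'b::euclidean_space) \<Rightarrow> bool" where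
  "in_Lp p \<Omega> u \<longleftrightarrow>
     u \<in> borel_measurable (lebesgue_on \<Omega>) \<and> integrable (lebesgue_on \<Omega>) (\<lambda>x. norm (u x) powr p)"

text \<open>\<open>W1p p \<Omega>\<close> is meant for open \<open>\<Omega>\<close> and \<open>1 \<le> p < \<infinity>\<close>; an \<open>L\<^sup>p\<close> function is then locally
  integrable, so both integrals in \<^const>\<open>weak_partial\<close> exist.\<close>

definition W1p :: "real \<Rightarrow> 'a::euclidean_space set \<Rightarrow> ('a \<Rightarrow> 'b::euclidean_space) \<Rightarrow> bool" where
  "W1p p \<Omega> u \<longleftrightarrow>
     in_Lp p \<Omega> u \<and> (\<forall>b\<in>Basis. \<exists>v. in_Lp p \<Omega> v \<and> weak_partial \<Omega> b u v)"

text \<open>Equality of boundary values of Sobolev maps: the extension of \<open>u - w\<close> by zero is again a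
  Sobolev map on the whole space. For a bounded Lipschitz domain \<open>\<Omega>\<close> and \<open>u\<close>, \<open>w\<close> in
  \<open>W\<^sup>1\<^sup>,\<^sup>p(\<Omega>)\<close> this says that \<open>u\<close> and \<open>w\<close> have the same trace on the boundary. Pointwise equality on
  the boundary, a null set, is no restriction on the Sobolev class.\<close>

definition same_trace ::
  "real \<Rightarrow> 'a::euclidean_space set \<Rightarrow> ('a \<Rightarrow> 'b::euclidean_space) \<Rightarrow> ('a \<Rightarrow> 'b) \<Rightarrow> bool" where
  "same_trace p \<Omega> u w \<longleftrightarrow> W1p p UNIV (\<lambda>x. if x \<in> \<Omega> then u x - w x else 0)"


section \<open>Degree on the boundary of a planar cube\<close>

definition cube :: "real \<times> real \<Rightarrow> real \<Rightarrow> (real \<times> real) set" where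
  "cube a r = {fst a - r..fst a + r} \<times> {snd a - r..snd a + r}"

definition cube_center :: "(real \<times> real) set \<Rightarrow> real \<times> real" where
  "cube_center R = (1/2) *\<^sub>R (interval_lowerbound R + interval_upperbound R)"

definition cube_radius :: "(real \<times> real) set \<Rightarrow> real" where
  "cube_radius R = (1/2) * (fst (interval_upperbound R) - fst (interval_lowerbound R))"

text \<open>The library's spheres \<^term>\<open>nsphere n\<close> consist of sequences \<open>nat \<Rightarrow> real\<close> vanishing from
  index \<open>n + 1\<close> on; the next two maps identify the plane with \<^term>\<open>Euclidean_space 2\<close>.\<close>

definition plane_of_seq :: "(nat \<Rightarrow> real) \<Rightarrow> real \<times> real" where
  "plane_of_seq u = (u 0, u 1)"

definition seq_of_plane :: "real \<times> real \<Rightarrow> nat \<Rightarrow> real" where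
  "seq_of_plane v = (\<lambda>i. if i = 0 then fst v else if i = 1 then snd v else 0)"

text \<open>Radial projection of the unit circle onto the boundary of the cube \<open>R\<close> (\<^const>\<open>infnorm\<close> is
  the maximum norm).\<close>

definition cube_boundary :: "(real \<times> real) set \<Rightarrow> real \<times> real \<Rightarrow> real \<times> real" where
  "cube_boundary R v = cube_center R + (cube_radius R / infnorm v) *\<^sub>R v"

text \<open>The Brouwer degree of \<open>f\<close>, restricted to the boundary of the cube \<open>R\<close>, at \<open>y\<close>: the degree of
  \<open>(f - y) / \<bar>f - y\<bar>\<close> as a map from that boundary to the unit circle, where the boundary
  is identified with the circle by the (orientation-preserving) radial projection.
  It depends only on the values of \<open>f\<close> on the boundary, and is meaningful only if these are
  continuous and different from \<open>y\<close>.\<close>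

definition brouwer_deg :: "(real \<times> real \<Rightarrow> real \<times> real) \<Rightarrow> (real \<times> real) set \<Rightarrow> real \<times> real \<Rightarrow> int" where
  "brouwer_deg f R y =
     Brouwer_degree2 1 (\<lambda>u. seq_of_plane (sgn (f (cube_boundary R (plane_of_seq u)) - y)))"

definition im_T :: "(real \<times> real \<Rightarrow> real \<times> real) \<Rightarrow> (real \<times> real) set \<Rightarrow> (real \<times> real) set" where
  "im_T f R = {y. y \<notin> f ` frontier R \<and> brouwer_deg f R y \<noteq> 0}"

lemma cube_eq_cbox: "cube a r = cbox (a - (r, r)) (a + (r, r))"
  by (cases a) (simp add: cube_def cbox_Pair_eq)

lemma cube_bounds:
  assumes "0 \<le> r"
  shows "interval_lowerbound (cube a r) = a - (r, r)"
    and "interval_upperbound (cube a r) = a + (r, r)"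
proof -
  have "\<forall>i\<in>Basis. (a - (r, r)) \<bullet> i \<le> (a + (r, r)) \<bullet> i"
    using assms by (cases a) (auto simp: Basis_prod_def)
  then show "interval_lowerbound (cube a r) = a - (r, r)"
    and "interval_upperbound (cube a r) = a + (r, r)"
    unfolding cube_eq_cbox by (rule interval_lowerbound, rule interval_upperbound)
qed

lemma cube_center_cube: "0 \<le> r \<Longrightarrow> cube_center (cube a r) = a"
  by (cases a) (simp add: cube_center_def cube_bounds)

lemma cube_radius_cube: "0 \<le> r \<Longrightarrow> cube_radius (cube a r) = r"
  by (cases a) (simp add: cube_radius_def cube_bounds)

lemma brouwer_deg_id_center:
  assumes "0 < r"
  shows "brouwer_deg (\<lambda>x. x) (cube a r) a = 1"
proof -
  have "Brouwer_degree2 1 (\<lambda>u. seq_of_plane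
      (sgn (cube_boundary (cube a r) (plane_of_seq u) - a))) = Brouwer_degree2 1 id"
  proof (rule Brouwer_degree2_eq)
    fix u :: "nat \<Rightarrow> real"
    assume "u \<in> topspace (nsphere 1)"
    then have u: "u 0 ^ 2 + u 1 ^ 2 = 1" and z: "\<And>i. i > 1 \<Longrightarrow> u i = 0"
      by (auto simp: nsphere)
    define v where "v = plane_of_seq u"
    have v: "norm v = 1"
      using u by (simp add: v_def plane_of_seq_def norm_Pair)
    then have "v \<noteq> 0"
      by auto
    then have "infnorm v > 0"
      by (simp add: infnorm_pos_lt)
    then have "sgn (cube_boundary (cube a r) v - a) = v"
      using assms v by (simp add: cube_boundary_def cube_center_cube cube_radius_cube sgn_scaleR
          sgn_div_norm)
    then have "seq_of_plane (sgn (cube_boundary (cube a r) v - a)) = u"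
      using z by (auto simp: v_def seq_of_plane_def plane_of_seq_def fun_eq_iff)
    then show "seq_of_plane (sgn (cube_boundary (cube a r) (plane_of_seq u) - a)) = id u"
      by (simp add: v_def)
  qed
  then show ?thesis
    by (simp add: brouwer_deg_def)
qed


section \<open>The (INV) condition\<close>

definition INV :: "(real \<times> real) set \<Rightarrow> (real \<times> real \<Rightarrow> real \<times> real) \<Rightarrow> (real \<times> real) set \<Rightarrow> bool" where
  "INV \<Omega> f R \<longleftrightarrow>
     compact (closure R) \<and> closure R \<subseteq> \<Omega> \<and>
     continuous_on (frontier R) f \<and>
     (AE x in lebesgue. x \<in> R \<longrightarrow> f x \<in> im_T f R \<union> f ` frontier R) \<and>
     (AE x in lebesgue. x \<in> \<Omega> - R \<longrightarrow> f x \<notin> im_T f R)"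

definition INV_cubes :: "(real \<times> real) set \<Rightarrow> (real \<times> real \<Rightarrow> real \<times> real) \<Rightarrow> bool" where
  "INV_cubes \<Omega> f \<longleftrightarrow>
     (\<forall>a\<in>\<Omega>. \<exists>r\<^sub>a>0. AE r in lebesgue. 0 < r \<and> r < r\<^sub>a \<longrightarrow> INV \<Omega> f (cube a r))"

end

theory Submission
  imports Defs
begin

text \<open>
  The map factors through the boundary of the big square: \<open>cav = rho \<circ> K\<close>, where \<open>rho\<close> is the radial
  retraction of the square onto its boundary and \<open>K\<close> is given by two piecewise affine maps, one on a lens-shaped
  region and one outside, that have the same directions where they meet. There are exactly three zeros.
  At two of them \<open>K\<close> has local degree 1, at the third one, \<open>ptA\<close>, which is the
  centre of the small cube, it has degree -1. The large cube contains \<open>ptA\<close> and the origin, but not \<open>ptB\<close>;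
  so the degree of \<open>cav\<close> on it vanishes, although the image of its boundary is the whole boundary of the square.

  The (INV) condition needs no degree computation. Degrees vanish outside the open square by a half-plane argument, and almost
  every point is mapped into the boundary of the square, so it suffices that \<open>cav R \<subseteq> cav (\<partial> R)\<close> for small
  cubes \<open>R\<close>. This holds because the level sets of \<open>cav\<close> do not end except at the three poles.

  The partial derivatives of \<open>cav\<close> are bounded by a multiple of the inverse distance to the nearest pole,
  hence are in \<open>L\<^sup>p\<close> for \<open>p < 2\<close>. They are weak derivatives by Fubini and the fundamental theorem of calculus,
  since \<open>cav\<close> is differentiable off finitely many lines.
\<close>

section \<open>Cubes in the plane\<close>

text \<open>Since the map is the identity on the outer boundary, the local degrees must add up to 1.
  A pole of degree -1 therefore needs a compensating one, and the large cube has to separate the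
  two. Room for the pair is made by sending a whole lens above the origin to the single point
  \<open>(0, 2)\<close>: any map of the lens with this value along its edge can then be inserted.
  The insertion lives on the rhombus with opposite vertices \<open>ptA\<close> and
  \<open>ptB\<close>; it runs each horizontal chord of the rhombus once around the boundary of the
  square, from and to \<open>(0, 2)\<close>. The pole \<open>ptA\<close> is prescribed by the small
  cube, \<open>ptB\<close> only has to lie in the lens and above the large cubes, and 9/8 is the
  mean of their heights. The top side of the large cube cuts the rhombus in such a chord, whose turn
  cancels the one made by the rest of that boundary. By \<open>t < 1/8\<close> this side stays below
  height 9/8, where it is reached by the rays from \<open>ptA\<close>.\<close>

lemma infnorm_pair: "infnorm (v :: real \<times> real) = max \<bar>fst v\<bar> \<bar>snd v\<bar>"
proof -
  have "{\<bar>v \<bullet> i\<bar> |i. i \<in> Basis} = {\<bar>fst v\<bar>, \<bar>snd v\<bar>}"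
    unfolding inner_prod_def Basis_prod_def by (cases v) force
  then show ?thesis
    by (simp add: infnorm_def cSup_eq_Max max_def)
qed

lemma norm_le_infnorm: "norm x \<le> 2 * infnorm (x :: real \<times> real)"
proof -
  have "norm x \<le> \<bar>fst x\<bar> + \<bar>snd x\<bar>"
    using norm_Pair_le[of "fst x" "snd x"] by simp
  then show ?thesis
    unfolding infnorm_pair by linarith
qed

lemma cube_infnorm: "cube a r = {x. infnorm (x - a) \<le> r}"
proof (intro Set.set_eqI)
  have *: "fst a - r \<le> p \<and> p \<le> fst a + r \<longleftrightarrow> \<bar>p - fst a\<bar> \<le> r"
    "snd a - r \<le> p \<and> p \<le> snd a + r \<longleftrightarrow> \<bar>p - snd a\<bar> \<le> r" for p
    by linarith+
  show "x \<in> cube a r \<longleftrightarrow> x \<in> {x. infnorm (x - a) \<le> r}" for x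
    by (simp add: cube_def infnorm_pair mem_Times_iff *)
qed

lemma frontier_cube: "frontier (cube a r) = {x. infnorm (x - a) = r}"
proof -
  have "box (a - (r, r)) (a + (r, r)) = {x. infnorm (x - a) < r}"
  proof (intro Set.set_eqI)
    have *: "fst a - r < p \<and> p < fst a + r \<longleftrightarrow> \<bar>p - fst a\<bar> < r"
      "snd a - r < p \<and> p < snd a + r \<longleftrightarrow> \<bar>p - snd a\<bar> < r" for p
      by linarith+
    show "x \<in> box (a - (r, r)) (a + (r, r)) \<longleftrightarrow> x \<in> {x. infnorm (x - a) < r}" for x
      by (simp add: box_prod infnorm_pair mem_Times_iff *)
  qed
  then show ?thesis
    unfolding cube_eq_cbox frontier_cbox unfolding cube_eq_cbox[symmetric] cube_infnorm
    by (force simp only: not_less order.eq_iff[of "infnorm _"])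
qed

lemma closed_cube: "closed (cube a r)"
  unfolding cube_eq_cbox by (rule closed_cbox)

lemma cube_boundary_cube:
  assumes "0 \<le> r"
  shows "cube_boundary (cube a r) v = a + (r / infnorm v) *\<^sub>R v"
  using assms by (simp add: cube_boundary_def cube_center_cube cube_radius_cube)

lemma cube_boundary_image:
  assumes "0 < r"
  shows "cube_boundary (cube a r) ` sphere 0 1 = frontier (cube a r)"
proof -
  have "cube_boundary (cube a r) v \<in> frontier (cube a r)" if "v \<in> sphere 0 1" for v
  proof -
    have "infnorm v \<noteq> 0"
      using that by (auto simp: infnorm_eq_0)
    then show ?thesis
      using assms by (simp add: frontier_cube cube_boundary_cube infnorm_mul infnorm_pos_le)
  qed
  moreover have "\<exists>v\<in>sphere 0 1. x = cube_boundary (cube a r) v" if "x \<in> frontier (cube a r)" for x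
  proof -
    let ?v = "sgn (x - a)"
    have x: "infnorm (x - a) = r" "x \<noteq> a"
      using that assms by (auto simp: frontier_cube infnorm_0)
    then have "infnorm ?v = r / norm (x - a)"
      by (simp add: sgn_div_norm infnorm_mul divide_inverse)
    then have "cube_boundary (cube a r) ?v = x"
      using assms x by (simp add: cube_boundary_cube sgn_div_norm)
    moreover have "?v \<in> sphere 0 1"
      using x by (simp add: norm_sgn)
    ultimately show ?thesis
      by metis
  qed
  ultimately show ?thesis
    by blast
qed

lemma continuous_on_cube_boundary:
  "0 < r \<Longrightarrow> continuous_on (sphere 0 1) (cube_boundary (cube a r))"
  by (subst continuous_on_cong[OF refl cube_boundary_cube], simp,
      intro continuous_intros ballI) (auto simp: infnorm_eq_0)

lemma connected_frontier_cube:
  assumes "0 < r"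
  shows "connected (frontier (cube a r))"
  unfolding cube_boundary_image[OF assms, symmetric]
  by (intro connected_continuous_image continuous_on_cube_boundary assms connected_sphere) simp

lemma segment_hits_frontier:
  fixes p x :: "real \<times> real"
  assumes "p \<notin> R" "x \<in> R" "closed R"
  obtains c where "0 < c" "c \<le> 1" "p + c *\<^sub>R (x - p) \<in> frontier R"
proof -
  have "closed_segment p x \<inter> frontier R \<noteq> {}"
    by (rule connected_Int_frontier) (use assms in auto)
  then obtain c where c: "0 \<le> c" "c \<le> 1" "(1 - c) *\<^sub>R p + c *\<^sub>R x \<in> frontier R"
    by (auto simp: closed_segment_def)
  moreover have "(1 - c) *\<^sub>R p + c *\<^sub>R x = p + c *\<^sub>R (x - p)"
    by (simp add: algebra_simps)
  ultimately have 1: "p + c *\<^sub>R (x - p) \<in> frontier R"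
    by simp
  moreover have "c \<noteq> 0"
    using 1 assms frontier_subset_closed[OF assms(3)] by auto
  ultimately show ?thesis
    using c by (intro that[of c]) auto
qed

text \<open>The row through \<open>x\<close> ends at two frontier points where \<open>m\<close> is
  below and above \<open>m x\<close>. The frontier is connected, so \<open>m\<close> takes the
  intermediate value on it.\<close>

lemma mono_hits_frontier:
  fixes m :: "real \<times> real \<Rightarrow> real"
  assumes r: "0 < r" and cont: "continuous_on (cube a r) m" and x: "x \<in> cube a r"
    and mono: "\<And>p q. p \<in> cube a r \<Longrightarrow> q \<in> cube a r \<Longrightarrow> snd p = snd q \<Longrightarrow> fst p \<le> fst q \<Longrightarrow> m p \<le> m q"
  obtains z where "z \<in> frontier (cube a r)" "m z = m x"
proof -
  let ?p = "(fst a - r, snd x)" and ?q = "(fst a + r, snd x)"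
  have x': "\<bar>fst x - fst a\<bar> \<le> r" "\<bar>snd x - snd a\<bar> \<le> r"
    using x by (auto simp: cube_infnorm infnorm_pair)
  then have pq: "?p \<in> frontier (cube a r)" "?q \<in> frontier (cube a r)"
    using r by (auto simp: frontier_cube infnorm_pair)
  have sub: "frontier (cube a r) \<subseteq> cube a r"
    by (rule frontier_subset_closed[OF closed_cube])
  have "m ?p \<le> m x" "m x \<le> m ?q"
    using pq sub x x' by (auto intro!: mono)
  moreover have "connected (m ` frontier (cube a r))"
    by (intro connected_continuous_image continuous_on_subset[OF cont sub] connected_frontier_cube r)
  ultimately have "m x \<in> m ` frontier (cube a r)"
    using pq connectedD_interval by blast
  then show ?thesis
    using that by auto
qed

lemma eventually_cube_subset:
  assumes "open U" "a \<in> U"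
  obtains d where "0 < d" "\<And>r x. r < d \<Longrightarrow> x \<in> cube a r \<Longrightarrow> x \<in> U"
proof -
  obtain e where e: "0 < e" "ball a e \<subseteq> U"
    using assms openE by blast
  have "x \<in> U" if "r < e / 2" "x \<in> cube a r" for r x
  proof -
    have "infnorm (x - a) < e / 2"
      using that by (simp add: cube_infnorm)
    then have "\<bar>fst (x - a)\<bar> + \<bar>snd (x - a)\<bar> < e"
      unfolding infnorm_pair max_less_iff_conj by linarith
    moreover have "norm (x - a) \<le> \<bar>fst (x - a)\<bar> + \<bar>snd (x - a)\<bar>"
      using norm_Pair_le[of "fst (x - a)" "snd (x - a)"] by (simp only: prod.collapse real_norm_def)
    ultimately have "dist a x < e"
      by (simp add: dist_norm norm_minus_commute)
    then show ?thesis
      using e(2) by auto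
  qed
  then show ?thesis
    using that[of "e / 2"] e(1) by auto
qed

section \<open>Degrees on the boundary of a cube\<close>

text \<open>The carrier of \<open>nsphere 1\<close>, named so that continuity of maps between the
  library's circles becomes a \<open>continuous_on\<close> statement.\<close>

definition circle :: "(nat \<Rightarrow> real) set" where
  "circle = {u. u 0 ^ 2 + u 1 ^ 2 = 1 \<and> (\<forall>i>1. u i = 0)}"

lemma nsphere_circle: "nsphere 1 = top_of_set circle"
  by (simp add: nsphere euclidean_product_topology circle_def)

lemma plane_of_circle: "plane_of_seq ` circle = sphere 0 1"
proof -
  have "plane_of_seq u \<in> sphere 0 1" if "u \<in> circle" for u
    using that by (auto simp: circle_def plane_of_seq_def norm_Pair)
  moreover have "v \<in> plane_of_seq ` circle" if "v \<in> sphere 0 1" for v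
  proof (rule image_eqI)
    show "v = plane_of_seq (seq_of_plane v)"
      by (simp add: plane_of_seq_def seq_of_plane_def)
    show "seq_of_plane v \<in> circle"
      using that by (cases v) (auto simp: circle_def seq_of_plane_def norm_Pair)
  qed
  ultimately show ?thesis
    by blast
qed

lemma seq_of_sphere: "v \<in> sphere 0 1 \<Longrightarrow> seq_of_plane v \<in> circle"
  by (cases v) (auto simp: circle_def seq_of_plane_def norm_Pair)

lemma continuous_on_plane_of_seq: "continuous_on S plane_of_seq"
  unfolding plane_of_seq_def
  by (intro continuous_intros continuous_on_product_coordinates continuous_on_subset[OF _ subset_UNIV])

lemma continuous_on_seq_of_plane: "continuous_on S seq_of_plane"
  unfolding seq_of_plane_def
proof (rule continuous_on_coordinatewise_then_product)
  show "continuous_on S (\<lambda>v. if i = 0 then fst v else if i = 1 then snd v else 0)" for i :: nat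
    by (cases "i = 0"; cases "i = 1") (simp_all add: continuous_on_fst continuous_on_snd continuous_on_id)
qed

text \<open>A homotopy without zeros can be normalised by \<open>sgn\<close> to a homotopy of
  self-maps of the circle. The base points \<open>y\<close> and \<open>z\<close> may differ, so the
  rule also serves to move the target point.\<close>

lemma brouwer_deg_homotopic:
  fixes h :: "real \<Rightarrow> real \<times> real \<Rightarrow> real \<times> real"
  assumes r: "0 < r"
    and cont: "continuous_on ({0..1} \<times> frontier (cube a r)) (\<lambda>(s, x). h s x)"
    and nz: "\<And>s x. s \<in> {0..1} \<Longrightarrow> x \<in> frontier (cube a r) \<Longrightarrow> h s x \<noteq> 0"
    and h0: "\<And>x. x \<in> frontier (cube a r) \<Longrightarrow> h 0 x = f x - y"
    and h1: "\<And>x. x \<in> frontier (cube a r) \<Longrightarrow> h 1 x = g x - z"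
  shows "brouwer_deg f (cube a r) y = brouwer_deg g (cube a r) z"
proof -
  let ?b = "\<lambda>u. cube_boundary (cube a r) (plane_of_seq u)"
  let ?h = "\<lambda>(s, u). seq_of_plane (sgn (h s (?b u)))"
  have b: "?b u \<in> frontier (cube a r)" if "u \<in> circle" for u
    using that cube_boundary_image[OF r] plane_of_circle by blast
  have bc: "continuous_on circle ?b"
    by (rule continuous_on_compose2[OF continuous_on_cube_boundary[OF r] continuous_on_plane_of_seq])
      (simp add: plane_of_circle)
  have nz': "h s (?b u) \<noteq> 0" if "s \<in> {0..1}" "u \<in> circle" for s u
    using that(1) b[OF that(2)] by (rule nz)
  have "continuous_on ({0..1} \<times> circle) (\<lambda>p. (fst p, ?b (snd p)))"
    by (intro continuous_intros continuous_on_compose2[OF bc]) auto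
  then have "continuous_on ({0..1} \<times> circle) (\<lambda>p. h (fst p) (?b (snd p)))"
    using continuous_on_compose2[OF cont, of "{0..1} \<times> circle" "\<lambda>p. (fst p, ?b (snd p))"] b
    by (simp add: image_subset_iff mem_Times_iff)
  then have "continuous_on ({0..1} \<times> circle) (\<lambda>p. sgn (h (fst p) (?b (snd p))))"
    using nz' by (intro continuous_on_sgn) auto
  then have "continuous_on ({0..1} \<times> circle) ?h"
    unfolding split_def by (intro continuous_on_compose2[OF continuous_on_seq_of_plane[of UNIV]]) auto
  moreover have "?h \<in> {0..1} \<times> circle \<rightarrow> circle"
    using nz' by (auto intro!: seq_of_sphere simp: norm_sgn)
  ultimately have "homotopic_with_canon (\<lambda>x. True) circle circle (\<lambda>u. ?h (0, u)) (\<lambda>u. ?h (1, u))"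
    unfolding homotopic_with_def by (intro exI[of _ ?h]) auto
  then have "Brouwer_degree2 1 (\<lambda>u. ?h (0, u)) = Brouwer_degree2 1 (\<lambda>u. ?h (1, u))"
    by (intro Brouwer_degree2_homotopic) (simp only: nsphere_circle prod.case)
  moreover have "Brouwer_degree2 1 (\<lambda>u. ?h (0, u)) = brouwer_deg f (cube a r) y"
    unfolding brouwer_deg_def by (rule Brouwer_degree2_eq) (auto simp: nsphere_circle[unfolded One_nat_def] b h0)
  moreover have "Brouwer_degree2 1 (\<lambda>u. ?h (1, u)) = brouwer_deg g (cube a r) z"
    unfolding brouwer_deg_def by (rule Brouwer_degree2_eq) (auto simp: nsphere_circle[unfolded One_nat_def] b h1)
  ultimately show ?thesis
    by simp
qed

lemma brouwer_deg_straight_line: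
  assumes "0 < r"
    and "continuous_on (frontier (cube a r)) f" "continuous_on (frontier (cube a r)) g"
    and "\<And>s x. s \<in> {0..1} \<Longrightarrow> x \<in> frontier (cube a r) \<Longrightarrow>
      (1 - s) *\<^sub>R (f x - y) + s *\<^sub>R (g x - z) \<noteq> 0"
  shows "brouwer_deg f (cube a r) y = brouwer_deg g (cube a r) z"
proof (rule brouwer_deg_homotopic[where h = "\<lambda>s x. (1 - s) *\<^sub>R (f x - y) + s *\<^sub>R (g x - z)"])
  let ?F = "frontier (cube a r)"
  have "continuous_on ({0..1::real} \<times> ?F) (\<lambda>p. f (snd p))"
    "continuous_on ({0..1::real} \<times> ?F) (\<lambda>p. g (snd p))"
    by (rule continuous_on_compose2[OF assms(2)] continuous_on_compose2[OF assms(3)],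
        rule continuous_on_snd[OF continuous_on_id], simp)+
  then show "continuous_on ({0..1} \<times> ?F) (\<lambda>(s, x). (1 - s) *\<^sub>R (f x - y) + s *\<^sub>R (g x - z))"
    unfolding split_def by (intro continuous_intros)
  show "(1 - s) *\<^sub>R (f x - y) + s *\<^sub>R (g x - z) \<noteq> 0" if "s \<in> {0..1}" "x \<in> ?F" for s x
    using that by (rule assms(4))
qed (simp_all add: assms(1))

text \<open>The normalised map misses the direction \<open>n\<close>, and a map that is not onto the
  circle has degree 0. Values on the bounding line are allowed, since only the one direction
  \<open>n\<close> has to be missed.\<close>

lemma brouwer_deg_half_plane:
  assumes r: "0 < r" and cont: "continuous_on (frontier (cube a r)) f"
    and "n \<noteq> 0" and half: "\<And>x. x \<in> frontier (cube a r) \<Longrightarrow> n \<bullet> (f x - y) \<le> 0"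
    and y: "y \<notin> f ` frontier (cube a r)"
  shows "brouwer_deg f (cube a r) y = 0"
proof -
  let ?b = "\<lambda>u. cube_boundary (cube a r) (plane_of_seq u)"
  let ?F = "\<lambda>u. seq_of_plane (sgn (f (?b u) - y))"
  have b: "?b u \<in> frontier (cube a r)" if "u \<in> circle" for u
    using that cube_boundary_image[OF r] plane_of_circle by blast
  have bc: "continuous_on circle ?b"
    by (rule continuous_on_compose2[OF continuous_on_cube_boundary[OF r] continuous_on_plane_of_seq])
      (simp add: plane_of_circle)
  have "continuous_on circle (\<lambda>u. f (?b u))"
    by (rule continuous_on_compose2[OF cont bc]) (use b in auto)
  then have "continuous_on circle (\<lambda>u. sgn (f (?b u) - y))"
    using b y by (intro continuous_on_sgn continuous_intros) auto
  then have "continuous_on circle ?F"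
    by (rule continuous_on_compose2[OF continuous_on_seq_of_plane]) auto
  moreover have "?F \<in> circle \<rightarrow> circle"
    using b y by (auto intro!: seq_of_sphere simp: norm_sgn)
  ultimately have "continuous_map (nsphere 1) (nsphere 1) ?F"
    unfolding nsphere_circle by simp
  moreover have "seq_of_plane (sgn n) \<notin> ?F ` circle"
  proof
    assume "seq_of_plane (sgn n) \<in> ?F ` circle"
    then obtain u where u: "u \<in> circle" "seq_of_plane (sgn n) = ?F u"
      by auto
    then have "plane_of_seq (seq_of_plane (sgn n)) = plane_of_seq (?F u)"
      by simp
    then have "sgn n = sgn (f (?b u) - y)"
      by (simp add: plane_of_seq_def seq_of_plane_def prod_eq_iff)
    then have "n \<bullet> sgn n = n \<bullet> (f (?b u) - y) / norm (f (?b u) - y)"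
      by (simp add: sgn_div_norm divide_inverse)
    also have "\<dots> \<le> 0"
      using half[OF b[OF u(1)]] by (simp add: divide_nonpos_nonneg)
    finally have "norm n \<le> 0"
      by (simp add: sgn_div_norm dot_square_norm power2_eq_square inverse_eq_divide split: if_splits)
    with \<open>n \<noteq> 0\<close> show False
      by simp
  qed
  moreover have "seq_of_plane (sgn n) \<in> circle"
    using \<open>n \<noteq> 0\<close> by (intro seq_of_sphere) (simp add: norm_sgn)
  ultimately show ?thesis
    unfolding brouwer_deg_def by (intro Brouwer_degree2_nonsurjective) (auto simp: nsphere_circle[unfolded One_nat_def])
qed

text \<open>The radial factor of \<open>cube_boundary\<close> is positive and disappears under
  \<open>sgn\<close>; what remains is the library's reflection in coordinate 0.\<close>

lemma brouwer_deg_reflection_fst: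
  assumes r: "0 < r"
  shows "brouwer_deg (\<lambda>x. (- fst (x - a), snd (x - a))) (cube a r) 0 = -1"
proof -
  have "seq_of_plane (sgn ((- fst (cube_boundary (cube a r) (plane_of_seq u) - a),
      snd (cube_boundary (cube a r) (plane_of_seq u) - a)) - 0)) = (\<lambda>i. if i = 0 then - u i else u i)"
    if u: "u \<in> circle" for u
  proof -
    let ?v = "plane_of_seq u"
    let ?w = "(- u 0, u 1)"
    have "?v \<in> sphere 0 1"
      using u plane_of_circle by blast
    then have "?v \<noteq> 0"
      by auto
    then have "0 < r / infnorm ?v"
      using r infnorm_pos_lt[of ?v] by simp
    moreover have "norm ?w = 1"
      using u by (simp add: circle_def norm_Pair)
    moreover have "(- fst (cube_boundary (cube a r) ?v - a), snd (cube_boundary (cube a r) ?v - a)) - 0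
        = (r / infnorm ?v) *\<^sub>R ?w"
      using r by (simp add: cube_boundary_cube plane_of_seq_def)
    ultimately have "sgn ((- fst (cube_boundary (cube a r) ?v - a), snd (cube_boundary (cube a r) ?v - a)) - 0) = ?w"
      by (simp only: sgn_scaleR sgn_pos scaleR_one) (simp add: sgn_div_norm)
    then show ?thesis
      using u by (auto simp: seq_of_plane_def circle_def fun_eq_iff)
  qed
  then have "brouwer_deg (\<lambda>x. (- fst (x - a), snd (x - a))) (cube a r) 0
      = Brouwer_degree2 1 (\<lambda>u i. if i = 0 then - u i else u i)"
    unfolding brouwer_deg_def by (intro Brouwer_degree2_eq) (simp only: nsphere_circle topspace_euclidean_subtopology)
  then show ?thesis
    by (simp only: Brouwer_degree2_reflection)
qed

lemma brouwer_deg_reflection_snd: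
  assumes r: "0 < r"
  shows "brouwer_deg (\<lambda>x. (fst (x - a), - snd (x - a))) (cube a r) 0 = -1"
proof -
  \<comment> \<open>For fixed \<open>s\<close> this is the reflection in the line at angle
    \<open>pi * s / 2\<close>. It joins the reflection in the horizontal axis to the one in the
    vertical axis, and by \<open>rot\<close> it preserves the Euclidean norm, so it has no zeros on
    the frontier.\<close>
  define h where "h = (\<lambda>s x. (cos (pi * s) * fst (x - a) + sin (pi * s) * snd (x - a),
    sin (pi * s) * fst (x - a) - cos (pi * s) * snd (x - a)))"
  have rot: "(c * u + t * w)^2 + (t * u - c * w)^2 = (t^2 + c^2) * (u^2 + w^2)" for c t u w :: real
    by (simp add: power2_eq_square algebra_simps)
  have "brouwer_deg (\<lambda>x. (fst (x - a), - snd (x - a))) (cube a r) 0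
      = brouwer_deg (\<lambda>x. (- fst (x - a), snd (x - a))) (cube a r) 0"
  proof (rule brouwer_deg_homotopic[OF r, where h = h])
    show "continuous_on ({0..1} \<times> frontier (cube a r)) (\<lambda>(s, x). h s x)"
      unfolding h_def split_def by (intro continuous_intros)
    show "h s x \<noteq> 0" if "x \<in> frontier (cube a r)" for s x
    proof
      let ?u = "fst (x - a)" and ?w = "snd (x - a)"
      assume "h s x = 0"
      then have "cos (pi * s) * ?u + sin (pi * s) * ?w = 0" "sin (pi * s) * ?u - cos (pi * s) * ?w = 0"
        by (simp_all add: h_def zero_prod_def)
      then have "0 = (cos (pi * s) * ?u + sin (pi * s) * ?w)^2 + (sin (pi * s) * ?u - cos (pi * s) * ?w)^2"
        by simp
      also have "\<dots> = ((sin (pi * s))^2 + (cos (pi * s))^2) * (?u^2 + ?w^2)"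
        by (rule rot)
      finally have "?u^2 + ?w^2 = 0"
        by simp
      then have "?u = 0" "?w = 0"
        by (simp_all only: sum_power2_eq_zero_iff)
      then have "infnorm (x - a) = 0"
        by (simp add: infnorm_pair)
      with that r show False
        by (simp add: frontier_cube)
    qed
  qed (simp_all add: h_def)
  with brouwer_deg_reflection_fst[OF r] show ?thesis
    by simp
qed

section \<open>Piecewise affine functions\<close>

text \<open>The domains of the pieces are not recorded: a finite list of affine functions, one of
  which gives the value at each point, together with continuity. In this form closure under maxima,
  minima and sums needs no geometry.\<close>

definition piecewise_affine :: "('a::euclidean_space \<Rightarrow> real) \<Rightarrow> bool" where
  "piecewise_affine k \<longleftrightarrow> continuous_on UNIV k \<and>
     (\<exists>A. finite A \<and> (\<forall>x. \<exists>p\<in>A. k x = fst p \<bullet> x + snd p))"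

lemma piecewise_affineE:
  assumes "piecewise_affine k"
  obtains A where "finite A" "\<And>x. \<exists>p\<in>A. k x = fst p \<bullet> x + snd p"
  using assms unfolding piecewise_affine_def by blast

lemma piecewise_affine_continuous: "piecewise_affine f \<Longrightarrow> continuous_on S f"
  by (meson continuous_on_subset piecewise_affine_def subset_UNIV)

lemma piecewise_affine_affine: "piecewise_affine (\<lambda>x. n \<bullet> x + c)"
  unfolding piecewise_affine_def
  by (intro conjI continuous_intros exI[of _ "{(n, c)}"]) auto

lemma piecewise_affine_const: "piecewise_affine (\<lambda>x. c)"
  using piecewise_affine_affine[of 0 c] by simp

lemma piecewise_affine_fst: "piecewise_affine (fst :: real \<times> real \<Rightarrow> real)"
proof -
  have "(\<lambda>x. (1, 0) \<bullet> x + 0) = (fst :: real \<times> real \<Rightarrow> real)"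
    by (rule ext) (simp add: inner_prod_def)
  then show ?thesis
    by (metis piecewise_affine_affine)
qed

lemma piecewise_affine_snd: "piecewise_affine (snd :: real \<times> real \<Rightarrow> real)"
proof -
  have "(\<lambda>x. (0, 1) \<bullet> x + 0) = (snd :: real \<times> real \<Rightarrow> real)"
    by (rule ext) (simp add: inner_prod_def)
  then show ?thesis
    by (metis piecewise_affine_affine)
qed

text \<open>Maximum, minimum and absolute value all pick one of two given values at each
  point.\<close>

lemma piecewise_affine_select:
  assumes "piecewise_affine f" "piecewise_affine g" "continuous_on UNIV h" "\<And>x. h x = f x \<or> h x = g x"
  shows "piecewise_affine h"
proof -
  obtain A where A: "finite A" "\<And>x. \<exists>p\<in>A. f x = fst p \<bullet> x + snd p"
    using piecewise_affineE[OF assms(1)] by blast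
  obtain B where B: "finite B" "\<And>x. \<exists>p\<in>B. g x = fst p \<bullet> x + snd p"
    using piecewise_affineE[OF assms(2)] by blast
  have "\<exists>p\<in>A \<union> B. h x = fst p \<bullet> x + snd p" for x
    using A(2)[of x] B(2)[of x] assms(4)[of x] by (metis UnI1 UnI2)
  then show ?thesis
    using A(1) B(1) assms(3) unfolding piecewise_affine_def by blast
qed

lemma piecewise_affine_max:
  assumes "piecewise_affine f" "piecewise_affine g"
  shows "piecewise_affine (\<lambda>x. max (f x) (g x))"
  by (rule piecewise_affine_select[OF assms continuous_on_max[OF assms[THEN piecewise_affine_continuous]]]) linarith

lemma piecewise_affine_min:
  assumes "piecewise_affine f" "piecewise_affine g"
  shows "piecewise_affine (\<lambda>x. min (f x) (g x))"
  by (rule piecewise_affine_select[OF assms continuous_on_min[OF assms[THEN piecewise_affine_continuous]]]) linarith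

lemma piecewise_affine_add:
  assumes "piecewise_affine f" "piecewise_affine g"
  shows "piecewise_affine (\<lambda>x. f x + g x)"
proof -
  obtain A where A: "finite A" "\<And>x. \<exists>p\<in>A. f x = fst p \<bullet> x + snd p"
    using piecewise_affineE[OF assms(1)] by blast
  obtain B where B: "finite B" "\<And>x. \<exists>p\<in>B. g x = fst p \<bullet> x + snd p"
    using piecewise_affineE[OF assms(2)] by blast
  let ?C = "(\<lambda>(p, q). p + q) ` (A \<times> B)"
  have "\<exists>p\<in>?C. f x + g x = fst p \<bullet> x + snd p" for x
  proof -
    obtain p q where "p \<in> A" "f x = fst p \<bullet> x + snd p" "q \<in> B" "g x = fst q \<bullet> x + snd q"
      using A(2) B(2) by blast
    then show ?thesis
      by (intro bexI[of _ "p + q"] image_eqI[of _ _ "(p, q)"]) (auto simp: inner_add_left)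
  qed
  moreover have "finite ?C"
    using A(1) B(1) by simp
  moreover have "continuous_on UNIV (\<lambda>x. f x + g x)"
    by (intro continuous_on_add piecewise_affine_continuous assms)
  ultimately show ?thesis
    unfolding piecewise_affine_def by blast
qed

lemma piecewise_affine_cmult:
  assumes "piecewise_affine f"
  shows "piecewise_affine (\<lambda>x. a * f x)"
proof -
  obtain A where A: "finite A" "\<And>x. \<exists>p\<in>A. f x = fst p \<bullet> x + snd p"
    using piecewise_affineE[OF assms] by blast
  let ?C = "(*\<^sub>R) a ` A"
  have "\<exists>p\<in>?C. a * f x = fst p \<bullet> x + snd p" for x
  proof -
    obtain p where "p \<in> A" "f x = fst p \<bullet> x + snd p"
      using A(2) by blast
    then show ?thesis
      by (intro bexI[of _ "a *\<^sub>R p"]) (auto simp: distrib_left)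
  qed
  moreover have "finite ?C"
    using A(1) by simp
  moreover have "continuous_on UNIV (\<lambda>x. a * f x)"
    by (intro continuous_on_mult_left piecewise_affine_continuous assms)
  ultimately show ?thesis
    unfolding piecewise_affine_def by blast
qed

lemma piecewise_affine_minus: "piecewise_affine f \<Longrightarrow> piecewise_affine (\<lambda>x. - f x)"
  using piecewise_affine_cmult[of f "-1"] by simp

lemma piecewise_affine_diff: "piecewise_affine f \<Longrightarrow> piecewise_affine g \<Longrightarrow> piecewise_affine (\<lambda>x. f x - g x)"
  using piecewise_affine_add[OF _ piecewise_affine_minus, of f g] by simp

lemma piecewise_affine_abs:
  assumes "piecewise_affine f"
  shows "piecewise_affine (\<lambda>x. \<bar>f x\<bar>)"
  by (rule piecewise_affine_select[OF assms piecewise_affine_minus[OF assms]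
        continuous_on_rabs[OF piecewise_affine_continuous[OF assms]]]) linarith

lemma piecewise_affine_divide_const: "piecewise_affine f \<Longrightarrow> piecewise_affine (\<lambda>x. f x / c)"
  using piecewise_affine_cmult[of f "1 / c"] by simp

lemmas piecewise_affine_intros =
  piecewise_affine_const piecewise_affine_fst piecewise_affine_snd piecewise_affine_max piecewise_affine_min
  piecewise_affine_add piecewise_affine_minus piecewise_affine_diff piecewise_affine_abs
  piecewise_affine_cmult piecewise_affine_divide_const

section \<open>Finite arrangements of hyperplanes and local affinity off them\<close>

definition hyperplanes :: "('a::euclidean_space \<times> real) set \<Rightarrow> bool" where
  "hyperplanes L \<longleftrightarrow> finite L \<and> (\<forall>p\<in>L. fst p \<noteq> 0)"

definition off :: "('a::euclidean_space \<times> real) set \<Rightarrow> 'a set" where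
  "off L = {x. \<forall>p\<in>L. fst p \<bullet> x + snd p \<noteq> 0}"

lemma hyperplanes_Un: "hyperplanes L \<Longrightarrow> hyperplanes M \<Longrightarrow> hyperplanes (L \<union> M)"
  by (auto simp: hyperplanes_def)

lemma off_Un: "off (L \<union> M) = off L \<inter> off M"
  by (auto simp: off_def)

lemma open_off:
  assumes "hyperplanes L"
  shows "open (off L)"
proof -
  have "off L = (\<Inter>p\<in>L. {x. fst p \<bullet> x + snd p \<noteq> 0})"
    by (auto simp: off_def)
  moreover have "open (\<Inter>p\<in>L. {x. fst p \<bullet> x + snd p \<noteq> 0})"
    using assms by (intro open_INT ballI open_Collect_neq continuous_intros) (simp add: hyperplanes_def)
  ultimately show ?thesis
    by simp
qed

text \<open>Two affine functions with different gradients agree only on a hyperplane, and two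
  distinct ones with equal gradients agree nowhere. Off these hyperplanes exactly one member of
  \<open>A\<close> has the value \<open>k x\<close>; by continuity the others remain excluded near
  \<open>x\<close>.\<close>

lemma piecewise_affine_locally_affine:
  assumes "piecewise_affine k"
  obtains L A where "hyperplanes L" "finite A"
    "\<And>x. x \<in> off L \<Longrightarrow> \<exists>p\<in>A. \<forall>\<^sub>F z in nhds x. k z = fst p \<bullet> z + snd p"
proof -
  obtain A where A: "finite A" "\<And>x. \<exists>p\<in>A. k x = fst p \<bullet> x + snd p"
    using piecewise_affineE[OF assms] by blast
  have cont: "continuous_on UNIV k"
    by (rule piecewise_affine_continuous[OF assms])
  define L where "L = (\<lambda>(p, q). p - q) ` {(p, q). p \<in> A \<and> q \<in> A \<and> fst p \<noteq> fst q}"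
  have "{(p, q). p \<in> A \<and> q \<in> A \<and> fst p \<noteq> fst q} \<subseteq> A \<times> A"
    by auto
  then have "finite L"
    unfolding L_def using A(1) by (meson finite_SigmaI finite_imageI finite_subset)
  moreover have "\<forall>p\<in>L. fst p \<noteq> 0"
    by (auto simp: L_def)
  ultimately have "hyperplanes L"
    by (simp add: hyperplanes_def)
  moreover have "\<exists>p\<in>A. \<forall>\<^sub>F z in nhds x. k z = fst p \<bullet> z + snd p" if x: "x \<in> off L" for x
  proof -
    obtain p where p: "p \<in> A" "k x = fst p \<bullet> x + snd p"
      using A(2) by blast
    have "\<forall>\<^sub>F z in nhds x. k z \<noteq> fst q \<bullet> z + snd q" if q: "q \<in> A - {p}" for q
    proof -
      have "k x \<noteq> fst q \<bullet> x + snd q"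
      proof (cases "fst p = fst q")
        case True
        then show ?thesis
          using q p by (auto simp: prod_eq_iff)
      next
        case False
        then have "p - q \<in> L"
          using q p unfolding L_def by (intro image_eqI[of _ _ "(p, q)"]) auto
        then have "fst (p - q) \<bullet> x + snd (p - q) \<noteq> 0"
          using x by (auto simp only: off_def)
        then show ?thesis
          using p by (simp add: inner_diff_left)
      qed
      moreover have "open {z. k z \<noteq> fst q \<bullet> z + snd q}"
        by (intro open_Collect_neq cont continuous_intros)
      ultimately show ?thesis
        using eventually_nhds_in_open[of "{z. k z \<noteq> fst q \<bullet> z + snd q}" x] by simp
    qed
    then have "\<forall>\<^sub>F z in nhds x. \<forall>q\<in>A - {p}. k z \<noteq> fst q \<bullet> z + snd q"
      using A(1) by (subst eventually_ball_finite_distrib) auto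
    then have "\<forall>\<^sub>F z in nhds x. k z = fst p \<bullet> z + snd p"
      by (rule eventually_mono) (use A(2) in blast)
    with p show ?thesis
      by blast
  qed
  ultimately show ?thesis
    using that A(1) by blast
qed

text \<open>The quotient itself is kept in the bound: for the coordinates of \<open>rho\<close> it
  is at most 2 in modulus, so that only the factor \<open>1 / \<bar>l x\<bar>\<close> is
  singular.\<close>

lemma quotient_derivative:
  fixes k l :: "'a::euclidean_space \<Rightarrow> real"
  assumes "piecewise_affine k" "piecewise_affine l"
  shows "\<exists>L M. hyperplanes L \<and> 0 \<le> M \<and>
    (\<forall>x\<in>off L. l x \<noteq> 0 \<longrightarrow> (\<exists>D. ((\<lambda>z. k z / l z) has_derivative D) (at x) \<and>
       (\<forall>b. \<bar>D b\<bar> \<le> M * norm b * (1 + \<bar>k x / l x\<bar>) / \<bar>l x\<bar>)))"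
proof -
  obtain L A where L: "hyperplanes L" "finite A"
    "\<And>x. x \<in> off L \<Longrightarrow> \<exists>p\<in>A. \<forall>\<^sub>F z in nhds x. k z = fst p \<bullet> z + snd p"
    using piecewise_affine_locally_affine[OF assms(1)] by blast
  obtain L' A' where L': "hyperplanes L'" "finite A'"
    "\<And>x. x \<in> off L' \<Longrightarrow> \<exists>p\<in>A'. \<forall>\<^sub>F z in nhds x. l z = fst p \<bullet> z + snd p"
    using piecewise_affine_locally_affine[OF assms(2)] by blast
  define M where "M = (\<Sum>p\<in>A \<union> A'. norm (fst p))"
  have M: "norm (fst p) \<le> M" if "p \<in> A \<union> A'" for p
    unfolding M_def by (rule member_le_sum) (use that L(2) L'(2) in auto)
  have "\<exists>D. ((\<lambda>z. k z / l z) has_derivative D) (at x) \<and>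
       (\<forall>b. \<bar>D b\<bar> \<le> M * norm b * (1 + \<bar>k x / l x\<bar>) / \<bar>l x\<bar>)" if x: "x \<in> off (L \<union> L')" and lx: "l x \<noteq> 0" for x
  proof -
    obtain n c where n: "(n, c) \<in> A" "\<forall>\<^sub>F z in nhds x. k z = n \<bullet> z + c"
      using L(3)[of x] x by (auto simp: off_Un)
    obtain m d where m: "(m, d) \<in> A'" "\<forall>\<^sub>F z in nhds x. l z = m \<bullet> z + d"
      using L'(3)[of x] x by (auto simp: off_Un)
    have eqx: "k x = n \<bullet> x + c" "l x = m \<bullet> x + d"
      using eventually_nhds_x_imp_x[OF n(2)] eventually_nhds_x_imp_x[OF m(2)] by auto
    define D where "D b = ((n \<bullet> b) * l x - k x * (m \<bullet> b)) / (l x * l x)" for b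
    have "((\<lambda>z. (n \<bullet> z + c) / (m \<bullet> z + d)) has_derivative D) (at x)"
      unfolding D_def eqx using lx eqx
      by (auto intro!: derivative_eq_intros simp: fun_eq_iff)
    moreover have "\<forall>\<^sub>F z in nhds x. (n \<bullet> z + c) / (m \<bullet> z + d) = k z / l z"
      using n(2) m(2) by eventually_elim simp
    then have "\<forall>\<^sub>F z in at x. (n \<bullet> z + c) / (m \<bullet> z + d) = k z / l z"
      by (simp only: eventually_nhds_conv_at)
    ultimately have "((\<lambda>z. k z / l z) has_derivative D) (at x)"
      by (rule has_derivative_transform_eventually) (simp_all add: eqx)
    moreover have "\<bar>D b\<bar> \<le> M * norm b * (1 + \<bar>k x / l x\<bar>) / \<bar>l x\<bar>" for b
    proof -
      have bn: "\<bar>q \<bullet> b\<bar> \<le> M * norm b" if "(q, e) \<in> A \<union> A'" for q e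
        using M[OF that] by (intro order.trans[OF Cauchy_Schwarz_ineq2] mult_right_mono) auto
      have "D b = (n \<bullet> b - (k x / l x) * (m \<bullet> b)) / l x"
        using lx by (simp add: D_def field_simps)
      then have "\<bar>D b\<bar> = \<bar>n \<bullet> b - (k x / l x) * (m \<bullet> b)\<bar> / \<bar>l x\<bar>"
        by simp
      also have "\<dots> \<le> (\<bar>n \<bullet> b\<bar> + \<bar>k x / l x\<bar> * \<bar>m \<bullet> b\<bar>) / \<bar>l x\<bar>"
        by (intro divide_right_mono order.trans[OF abs_triangle_ineq4]) (auto simp: abs_mult)
      also have "\<dots> \<le> (M * norm b + \<bar>k x / l x\<bar> * (M * norm b)) / \<bar>l x\<bar>"
        using n(1) m(1) by (intro divide_right_mono add_mono mult_left_mono bn) auto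
      also have "\<dots> = M * norm b * (1 + \<bar>k x / l x\<bar>) / \<bar>l x\<bar>"
        by (simp add: distrib_left mult.commute)
      finally show ?thesis .
    qed
    ultimately show ?thesis
      by blast
  qed
  moreover have "0 \<le> M"
    unfolding M_def by (rule sum_nonneg) simp
  ultimately show ?thesis
    using hyperplanes_Un[OF L(1) L'(1)] by (intro exI[of _ "L \<union> L'"] exI[of _ M]) blast
qed

section \<open>Weak partial derivatives\<close>

lemma test_functionD:
  assumes "test_function \<Omega> \<phi>"
  shows "\<phi> differentiable at x" "b \<in> Basis \<Longrightarrow> continuous_on UNIV (\<lambda>x. frechet_derivative \<phi> (at x) b)"
    and "continuous_on S \<phi>"
proof -
  have "Ck 1 \<phi>"
    using assms unfolding test_function_def by blast
  then have d: "\<And>x. \<phi> differentiable at x"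
    by simp
  then show "\<phi> differentiable at x" .
  show "continuous_on UNIV (\<lambda>x. frechet_derivative \<phi> (at x) b)" if "b \<in> Basis"
    using \<open>Ck 1 \<phi>\<close> that by simp
  show "continuous_on S \<phi>"
    by (meson continuous_at_imp_continuous_on d differentiable_imp_continuous_within)
qed

lemma frechet_derivative_eq_0_outside:
  fixes \<phi> :: "'a::euclidean_space \<Rightarrow> real"
  assumes "compact K" "\<And>x. x \<notin> K \<Longrightarrow> \<phi> x = 0" "x \<notin> K"
  shows "frechet_derivative \<phi> (at x) b = 0"
proof -
  have "open (- K)"
    using assms(1) by (simp add: compact_imp_closed open_Compl)
  then have "(\<phi> has_derivative (\<lambda>_. 0)) (at x)"
    by (rule has_derivative_transform_within_open[OF has_derivative_const[of 0]]) (use assms in auto)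
  then show ?thesis
    using frechet_derivative_at by metis
qed

lemma test_function_support:
  assumes "test_function \<Omega> \<phi>"
  shows "\<exists>K. compact K \<and> K \<subseteq> \<Omega> \<and> (\<forall>x. x \<notin> K \<longrightarrow> \<phi> x = 0 \<and> (\<forall>b. frechet_derivative \<phi> (at x) b = 0))"
proof -
  obtain K where K: "compact K" "K \<subseteq> \<Omega>" "\<And>x. x \<notin> K \<Longrightarrow> \<phi> x = 0"
    using assms unfolding test_function_def by blast
  show ?thesis
    by (intro exI[of _ K] conjI allI impI K frechet_derivative_eq_0_outside[OF K(1,3)])
qed

text \<open>The integrand is the derivative of the product of \<open>\<phi>\<close> and
  \<open>u\<close> along the line, and the product vanishes at both ends of a long interval.
  Continuity of \<open>u\<close> on the line makes the finitely many exceptional points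
  harmless.\<close>

lemma line_integral_eq_0:
  fixes u v :: "'a::euclidean_space \<Rightarrow> 'b::euclidean_space"
  assumes \<phi>: "test_function UNIV \<phi>" and b: "b \<in> Basis"
    and cont: "continuous_on UNIV (\<lambda>t. u (a + t *\<^sub>R b))"
    and "finite E" and deriv: "\<And>t. t \<notin> E \<Longrightarrow> ((\<lambda>s. u (a + s *\<^sub>R b)) has_vector_derivative v (a + t *\<^sub>R b)) (at t)"
  shows "(LBINT t. frechet_derivative \<phi> (at (a + t *\<^sub>R b)) b *\<^sub>R u (a + t *\<^sub>R b)
    + \<phi> (a + t *\<^sub>R b) *\<^sub>R v (a + t *\<^sub>R b)) = 0" (is "integral\<^sup>L lborel ?g = 0")
proof (cases "integrable lborel ?g")
  case True
  obtain K where K': "compact K \<and> K \<subseteq> UNIV \<and> (\<forall>x. x \<notin> K \<longrightarrow> \<phi> x = 0 \<and> (\<forall>b. frechet_derivative \<phi> (at x) b = 0))"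
    using test_function_support[OF \<phi>] ..
  have K: "compact K" "K \<subseteq> UNIV" "\<And>x. x \<notin> K \<Longrightarrow> \<phi> x = 0"
    "\<And>x b. x \<notin> K \<Longrightarrow> frechet_derivative \<phi> (at x) b = 0"
    using K' by blast+
  obtain B where B: "\<And>x. x \<in> K \<Longrightarrow> norm x \<le> B"
    using compact_imp_bounded[OF K(1)] by (auto simp: bounded_iff)
  define M where "M = \<bar>B\<bar> + norm a + 1"
  have M: "a + t *\<^sub>R b \<notin> K" if "M \<le> \<bar>t\<bar>" for t
  proof
    assume "a + t *\<^sub>R b \<in> K"
    then have "norm (a + t *\<^sub>R b) \<le> B"
      by (rule B)
    moreover have "\<bar>t\<bar> \<le> norm (a + t *\<^sub>R b) + norm a"
      using norm_triangle_ineq4[of "a + t *\<^sub>R b" a] b by simp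
    ultimately show False
      using that by (simp add: M_def)
  qed
  have M0: "0 \<le> M"
    by (simp add: M_def)
  have g0: "?g t = 0" if "M \<le> \<bar>t\<bar>" for t
    by (simp only: K(3,4)[OF M[OF that]] scaleR_zero_left add_0)
  let ?h = "\<lambda>t. \<phi> (a + t *\<^sub>R b) *\<^sub>R u (a + t *\<^sub>R b)"
  have "(?g has_integral (?h M - ?h (- M))) {- M..M}"
  proof (rule fundamental_theorem_of_calculus_interior_strong[OF \<open>finite E\<close>])
    show "continuous_on {- M..M} ?h"
      by (intro continuous_on_scaleR continuous_on_compose2[OF test_functionD(3)[OF \<phi>, of UNIV]]
          continuous_on_subset[OF cont] continuous_intros) auto
    show "(?h has_vector_derivative ?g t) (at t)" if "t \<in> {- M<..<M} - E" for t
    proof -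
      have "(\<phi> has_derivative frechet_derivative \<phi> (at (a + t *\<^sub>R b))) (at (a + t *\<^sub>R b))"
        using test_functionD(1)[OF \<phi>] by (simp add: frechet_derivative_works)
      moreover have "((\<lambda>s. a + s *\<^sub>R b) has_vector_derivative b) (at t)"
        by (auto intro!: derivative_eq_intros)
      ultimately have "((\<phi> \<circ> (\<lambda>s. a + s *\<^sub>R b)) has_vector_derivative frechet_derivative \<phi> (at (a + t *\<^sub>R b)) b) (at t)"
        by (intro vector_derivative_diff_chain_within) (auto intro: has_derivative_at_withinI)
      then have "((\<lambda>s. \<phi> (a + s *\<^sub>R b)) has_field_derivative frechet_derivative \<phi> (at (a + t *\<^sub>R b)) b) (at t)"
        by (simp add: o_def has_real_derivative_iff_has_vector_derivative)
      from has_vector_derivative_scaleR[OF this deriv] that show ?thesis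
        by (simp add: add.commute)
    qed
  qed (use M0 in simp)
  moreover have "?h M = 0" "?h (- M) = 0"
    using M[of M] M[of "- M"] K(3) M0 by auto
  ultimately have "(?g has_integral 0) {- M..M}"
    by (simp only: diff_self)
  then have "(?g has_integral 0) UNIV"
    by (rule has_integral_on_superset) (auto intro!: g0)
  with has_integral_integral_lborel[OF True] show ?thesis
    by (rule has_integral_unique)
\<comment> \<open>A function that is not integrable has integral 0 by convention.\<close>
qed (rule not_integrable_integral_eq)

text \<open>A line in direction \<open>b\<close> meets a hyperplane in at most one point unless the
  hyperplane is parallel to \<open>b\<close>. The parallel ones have finitely many heights
  \<open>- snd p / (fst p \<bullet> c)\<close>, which go into \<open>B\<close> together with the
  heights of the points of \<open>S\<close>. A vanishing denominator merely adds the height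
  0.\<close>

lemma finite_bad_lines:
  fixes L :: "((real \<times> real) \<times> real) set"
  assumes L: "hyperplanes L" and S: "finite S" and bc: "b \<in> Basis" "c \<in> Basis" "b \<noteq> c"
  obtains B where "finite B"
    "\<And>y. y \<notin> B \<Longrightarrow> finite {t. y *\<^sub>R c + t *\<^sub>R b \<notin> off L}" "\<And>y t. y \<notin> B \<Longrightarrow> y *\<^sub>R c + t *\<^sub>R b \<notin> S"
proof
  let ?B = "(\<lambda>s. s \<bullet> c) ` S \<union> (\<lambda>p. - snd p / (fst p \<bullet> c)) ` L"
  show "finite ?B"
    using L S by (simp add: hyperplanes_def)
  have cb: "b \<bullet> c = 0" "c \<bullet> c = 1"
    using bc by (auto simp: inner_Basis)
  show "y *\<^sub>R c + t *\<^sub>R b \<notin> S" if "y \<notin> ?B" for y t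
  proof
    assume "y *\<^sub>R c + t *\<^sub>R b \<in> S"
    then have "(y *\<^sub>R c + t *\<^sub>R b) \<bullet> c \<in> ?B"
      by blast
    with that show False
      by (simp add: cb inner_add_left)
  qed
  show "finite {t. y *\<^sub>R c + t *\<^sub>R b \<notin> off L}" if y: "y \<notin> ?B" for y
  proof (rule finite_subset)
    show "{t. y *\<^sub>R c + t *\<^sub>R b \<notin> off L} \<subseteq> (\<lambda>p. - (y * (fst p \<bullet> c) + snd p) / (fst p \<bullet> b)) ` L"
    proof
      fix t
      assume "t \<in> {t. y *\<^sub>R c + t *\<^sub>R b \<notin> off L}"
      then obtain p where p: "p \<in> L" "fst p \<bullet> (y *\<^sub>R c + t *\<^sub>R b) + snd p = 0"
        by (auto simp: off_def)
      then have eq: "y * (fst p \<bullet> c) + t * (fst p \<bullet> b) + snd p = 0"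
        by (simp add: inner_add_right)
      have "fst p \<bullet> b \<noteq> 0"
      proof
        assume 0: "fst p \<bullet> b = 0"
        have "fst p \<noteq> 0"
          using L p(1) by (auto simp: hyperplanes_def)
        then have "fst p \<bullet> c \<noteq> 0"
          using 0 bc by (cases "fst p") (auto simp: Basis_prod_def inner_prod_def zero_prod_def)
        then have "y = - snd p / (fst p \<bullet> c)"
          using eq 0 by (simp add: field_simps)
        then show False
          using y p(1) by blast
      qed
      then have "t = - (y * (fst p \<bullet> c) + snd p) / (fst p \<bullet> b)"
        using eq by (simp add: field_simps)
      with p(1) show "t \<in> (\<lambda>p. - (y * (fst p \<bullet> c) + snd p) / (fst p \<bullet> b)) ` L"
        by blast
    qed
  qed (use L in \<open>simp add: hyperplanes_def\<close>)
qed

lemma integral_eq_0_lines: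
  fixes g :: "real \<times> real \<Rightarrow> 'b::euclidean_space"
  assumes g: "integrable lborel g" and B: "finite B" and bc: "b \<in> Basis" "c \<in> Basis" "b \<noteq> c"
    and lines: "\<And>y. y \<notin> B \<Longrightarrow> (LBINT t. g (y *\<^sub>R c + t *\<^sub>R b)) = 0"
  shows "integral\<^sup>L lborel g = 0"
proof -
  have AE: "AE y in lborel. (LBINT t. g (y *\<^sub>R c + t *\<^sub>R b)) = 0"
    using AE_not_in[OF finite_imp_null_set_lborel[OF B]] by eventually_elim (use lines in simp)
  have g': "integrable (lborel \<Otimes>\<^sub>M lborel) (\<lambda>(x, y). g (x, y))"
    using g by (simp add: lborel_prod)
  consider "b = (1, 0)" "c = (0, 1)" | "b = (0, 1)" "c = (1, 0)"
    using bc by (auto simp: Basis_prod_def)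
  then show ?thesis
  proof cases
    case 1
    then have "(LBINT y. LBINT t. g (t, y)) = 0"
      using AE by (intro integral_eq_zero_AE) simp
    then show ?thesis
      using lborel_pair.integral_snd[OF g'] by (simp add: lborel_prod)
  next
    case 2
    then have "(LBINT y. LBINT t. g (y, t)) = 0"
      using AE by (intro integral_eq_zero_AE) simp
    then show ?thesis
      using lborel_pair.integral_fst[OF g'] by (simp add: lborel_prod)
  qed
qed

text \<open>The hyperplanes meet almost every line parallel to a coordinate axis in finitely many points.\<close>

lemma weak_partial_lines:
  fixes u v :: "real \<times> real \<Rightarrow> 'b::euclidean_space"
  assumes L: "hyperplanes L" and S: "finite S" and b: "b \<in> Basis"
    and cont: "continuous_on (- S) u"
    and bound: "\<And>B. \<exists>C. \<forall>x. norm x \<le> B \<longrightarrow> norm (u x) \<le> C"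
    and v: "v \<in> borel_measurable borel" "\<And>a c. set_integrable lborel (cbox a c) v"
    and deriv: "\<And>x. x \<in> off L \<Longrightarrow> ((\<lambda>t. u (x + t *\<^sub>R b)) has_vector_derivative v x) (at 0)"
  shows "weak_partial UNIV b u v"
  unfolding weak_partial_def
proof (intro allI impI)
  fix \<phi> :: "real \<times> real \<Rightarrow> real"
  assume \<phi>: "test_function UNIV \<phi>"
  let ?d = "\<lambda>x. frechet_derivative \<phi> (at x) b"
  obtain K where K': "compact K \<and> K \<subseteq> UNIV \<and> (\<forall>x. x \<notin> K \<longrightarrow> \<phi> x = 0 \<and> (\<forall>b. frechet_derivative \<phi> (at x) b = 0))"
    using test_function_support[OF \<phi>] ..
  have K: "compact K" "K \<subseteq> UNIV" "\<And>x. x \<notin> K \<Longrightarrow> \<phi> x = 0"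
    "\<And>x b. x \<notin> K \<Longrightarrow> frechet_derivative \<phi> (at x) b = 0"
    using K' by blast+
  have u_meas [measurable]: "u \<in> borel_measurable borel"
    using S cont by (intro borel_measurable_continuous_countable_exceptions countable_finite)
  have d_meas [measurable]: "?d \<in> borel_measurable borel"
    by (intro borel_measurable_continuous_onI test_functionD(2)[OF \<phi> b])
  have \<phi>_meas [measurable]: "\<phi> \<in> borel_measurable borel"
    by (intro borel_measurable_continuous_onI test_functionD(3)[OF \<phi>])
  note v(1) [measurable]
  obtain a c where ac: "K \<subseteq> cbox a c"
    using bounded_subset_cbox_symmetric[OF compact_imp_bounded[OF K(1)]] by metis
  obtain B where B: "\<And>x. x \<in> cbox a c \<Longrightarrow> norm x \<le> B"
    using bounded_cbox[of a c] by (auto simp: bounded_iff)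
  obtain C where C: "\<And>x. norm x \<le> B \<Longrightarrow> norm (u x) \<le> C"
    using bound by blast
  have bdd: "\<exists>C\<ge>0. \<forall>x. \<bar>h x\<bar> \<le> C" if "continuous_on UNIV h" "\<And>x. x \<notin> K \<Longrightarrow> h x = 0" for h :: "real \<times> real \<Rightarrow> real"
  proof -
    have "bounded (h ` K)"
      using K(1) that(1) by (meson compact_continuous_image compact_imp_bounded continuous_on_subset subset_UNIV)
    then obtain C where "\<forall>x\<in>K. \<bar>h x\<bar> \<le> C"
      by (auto simp: bounded_iff)
    then have "\<forall>x. \<bar>h x\<bar> \<le> max 0 C"
      using that(2) by (metis abs_zero max.cobounded1 max.coboundedI2)
    then show ?thesis
      by (meson max.cobounded1)
  qed
  obtain C1 where C1: "0 \<le> C1" "\<And>x. \<bar>?d x\<bar> \<le> C1"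
    using bdd[OF test_functionD(2)[OF \<phi> b] K(4)] by blast
  obtain C2 where C2: "0 \<le> C2" "\<And>x. \<bar>\<phi> x\<bar> \<le> C2"
    using bdd[OF test_functionD(3)[OF \<phi>] K(3)] by blast
  have int1: "integrable lborel (\<lambda>x. ?d x *\<^sub>R u x)"
  proof (rule Bochner_Integration.integrable_bound)
    show "integrable lborel (\<lambda>x. indicator (cbox a c) x * (C1 * C))"
      by (intro integrable_mult_left integrable_real_indicator) (auto simp: emeasure_lborel_cbox_eq)
    show "AE x in lborel. norm (?d x *\<^sub>R u x) \<le> norm (indicator (cbox a c) x * (C1 * C))"
    proof (intro AE_I2)
      fix x
      show "norm (?d x *\<^sub>R u x) \<le> norm (indicator (cbox a c) x * (C1 * C))"
      proof (cases "x \<in> cbox a c")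
        case True
        then have "norm (u x) \<le> C"
          by (intro C B)
        then have "\<bar>?d x\<bar> * norm (u x) \<le> C1 * C"
          using C1 by (intro mult_mono) auto
        also have "\<dots> \<le> \<bar>C1 * C\<bar>"
          by simp
        finally show ?thesis
          using True by simp
      next
        case False
        then have "?d x = 0"
          using K(4) ac by blast
        then show ?thesis
          by simp
      qed
    qed
  qed measurable
  have int2: "integrable lborel (\<lambda>x. \<phi> x *\<^sub>R v x)"
  proof (rule Bochner_Integration.integrable_bound)
    show "integrable lborel (\<lambda>x. C2 *\<^sub>R (indicator (cbox a c) x *\<^sub>R v x))"
      using v(2)[of a c] by (intro integrable_scaleR_right) (simp add: set_integrable_def)
    show "AE x in lborel. norm (\<phi> x *\<^sub>R v x) \<le> norm (C2 *\<^sub>R (indicator (cbox a c) x *\<^sub>R v x))"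
    proof (intro AE_I2)
      fix x
      show "norm (\<phi> x *\<^sub>R v x) \<le> norm (C2 *\<^sub>R (indicator (cbox a c) x *\<^sub>R v x))"
      proof (cases "x \<in> cbox a c")
        case True
        have "\<bar>\<phi> x\<bar> * norm (v x) \<le> C2 * norm (v x)"
          by (intro mult_right_mono C2) simp
        with True C2(1) show ?thesis
          by simp
      next
        case False
        then have "\<phi> x = 0"
          using K(3) ac by blast
        then show ?thesis
          by simp
      qed
    qed
  qed measurable
  \<comment> \<open>Swapping the coordinates turns one basis vector of the plane into the
    other.\<close>
  define c' where "c' = (snd b, fst b)"
  have c': "c' \<in> Basis" "b \<noteq> c'"
    using b by (auto simp: Basis_prod_def c'_def)
  obtain E where E: "finite E" "\<And>y. y \<notin> E \<Longrightarrow> finite {t. y *\<^sub>R c' + t *\<^sub>R b \<notin> off L}"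
      "\<And>y t. y \<notin> E \<Longrightarrow> y *\<^sub>R c' + t *\<^sub>R b \<notin> S"
    using finite_bad_lines[OF L S b c'] by blast
  have "(LBINT x. ?d x *\<^sub>R u x + \<phi> x *\<^sub>R v x) = 0"
  proof (rule integral_eq_0_lines[OF _ E(1) b c'])
    show "integrable lborel (\<lambda>x. ?d x *\<^sub>R u x + \<phi> x *\<^sub>R v x)"
      by (intro Bochner_Integration.integrable_add int1 int2)
    fix y
    assume y: "y \<notin> E"
    show "(LBINT t. ?d (y *\<^sub>R c' + t *\<^sub>R b) *\<^sub>R u (y *\<^sub>R c' + t *\<^sub>R b)
        + \<phi> (y *\<^sub>R c' + t *\<^sub>R b) *\<^sub>R v (y *\<^sub>R c' + t *\<^sub>R b)) = 0"
    proof (rule line_integral_eq_0[OF \<phi> b _ E(2)[OF y]])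
      show "continuous_on UNIV (\<lambda>t. u (y *\<^sub>R c' + t *\<^sub>R b))"
        using E(3)[OF y] by (intro continuous_on_compose2[OF cont] continuous_intros) auto
      show "((\<lambda>s. u (y *\<^sub>R c' + s *\<^sub>R b)) has_vector_derivative v (y *\<^sub>R c' + t *\<^sub>R b)) (at t)"
        if "t \<notin> {t. y *\<^sub>R c' + t *\<^sub>R b \<notin> off L}" for t
      proof -
        have "((\<lambda>s. u ((y *\<^sub>R c' + t *\<^sub>R b) + s *\<^sub>R b)) has_vector_derivative v (y *\<^sub>R c' + t *\<^sub>R b)) (at (t - t))"
          using deriv[of "y *\<^sub>R c' + t *\<^sub>R b"] that by simp
        then have "(((\<lambda>s. u ((y *\<^sub>R c' + t *\<^sub>R b) + s *\<^sub>R b)) \<circ> (\<lambda>s. s - t)) has_vector_derivative 1 *\<^sub>R v (y *\<^sub>R c' + t *\<^sub>R b)) (at t)"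
          by (intro vector_diff_chain_at) (auto intro!: derivative_eq_intros)
        moreover have "(\<lambda>s. u ((y *\<^sub>R c' + t *\<^sub>R b) + s *\<^sub>R b)) \<circ> (\<lambda>s. s - t) = (\<lambda>s. u (y *\<^sub>R c' + s *\<^sub>R b))"
          by (simp add: fun_eq_iff algebra_simps)
        ultimately show ?thesis
          by simp
      qed
    qed
  qed
  then have "(LBINT x. ?d x *\<^sub>R u x) + (LBINT x. \<phi> x *\<^sub>R v x) = 0"
    using Bochner_Integration.integral_add[OF int1 int2] by simp
  then show "(LINT x|lebesgue_on UNIV. ?d x *\<^sub>R u x) = - (LINT x|lebesgue_on UNIV. \<phi> x *\<^sub>R v x)"
    by (simp add: lebesgue_on_UNIV_eq integral_completion eq_neg_iff_add_eq_0)
qed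

text \<open>Test functions on the smaller set are test functions on the plane, and both integrands
  vanish off the support, so restricting the domain does not change the integrals.\<close>

lemma weak_partial_subset:
  assumes "weak_partial UNIV b u v" "\<Omega> \<in> sets lebesgue"
  shows "weak_partial \<Omega> b u v"
  unfolding weak_partial_def
proof (intro allI impI)
  fix \<phi> assume \<phi>: "test_function \<Omega> \<phi>"
  then have "test_function UNIV \<phi>"
    by (auto simp: test_function_def)
  then have eq: "(LINT x|lebesgue. frechet_derivative \<phi> (at x) b *\<^sub>R u x) = - (LINT x|lebesgue. \<phi> x *\<^sub>R v x)"
    using assms(1) by (simp add: weak_partial_def lebesgue_on_UNIV_eq)
  obtain K where K': "compact K \<and> K \<subseteq> \<Omega> \<and> (\<forall>x. x \<notin> K \<longrightarrow> \<phi> x = 0 \<and> (\<forall>b. frechet_derivative \<phi> (at x) b = 0))"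
    using test_function_support[OF \<phi>] ..
  have K: "compact K" "K \<subseteq> \<Omega>" "\<And>x. x \<notin> K \<Longrightarrow> \<phi> x = 0"
    "\<And>x b. x \<notin> K \<Longrightarrow> frechet_derivative \<phi> (at x) b = 0"
    using K' by blast+
  have ind: "indicator \<Omega> x *\<^sub>R frechet_derivative \<phi> (at x) b *\<^sub>R u x = frechet_derivative \<phi> (at x) b *\<^sub>R u x"
    "indicator \<Omega> x *\<^sub>R \<phi> x *\<^sub>R v x = \<phi> x *\<^sub>R v x" for x
    using K by (auto simp: indicator_def)
  have \<Omega>: "\<Omega> \<inter> space lebesgue \<in> sets lebesgue"
    using assms(2) by simp
  show "(LINT x|lebesgue_on \<Omega>. frechet_derivative \<phi> (at x) b *\<^sub>R u x) = - (LINT x|lebesgue_on \<Omega>. \<phi> x *\<^sub>R v x)"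
    by (simp only: integral_restrict_space[OF \<Omega>] ind eq)
qed

text \<open>The function is a pointwise limit of difference quotients with steps
  \<open>1 / (n + 1)\<close>. This makes a derivative field obtained by choice measurable.\<close>

lemma borel_measurable_directional_derivative:
  fixes u :: "'a::euclidean_space \<Rightarrow> 'b::euclidean_space"
  assumes [measurable]: "u \<in> borel_measurable borel" and G [measurable]: "G \<in> sets borel" and "b \<noteq> 0"
    and D: "\<And>x. x \<in> G \<Longrightarrow> (u has_derivative D x) (at x)"
  shows "(\<lambda>x. if x \<in> G then D x b else 0) \<in> borel_measurable borel"
proof (rule borel_measurable_LIMSEQ_metric)
  let ?h = "\<lambda>n :: nat. inverse (real (Suc n))"
  let ?q = "\<lambda>n x. if x \<in> G then real (Suc n) *\<^sub>R (u (x + ?h n *\<^sub>R b) - u x) else 0"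
  show "?q n \<in> borel_measurable borel" for n
    by measurable
  show "(\<lambda>n. ?q n x) \<longlonglongrightarrow> (if x \<in> G then D x b else 0)" for x
  proof (cases "x \<in> G")
    case True
    then have lin: "bounded_linear (D x)"
      and lim: "filterlim (\<lambda>h. norm (u (x + h) - u x - D x h) / norm h) (nhds 0) (at 0)"
      using D has_derivative_at by blast+
    have "(\<lambda>n. ?h n *\<^sub>R b) \<longlonglongrightarrow> 0 *\<^sub>R b"
      by (intro tendsto_scaleR tendsto_const LIMSEQ_inverse_real_of_nat)
    then have "filterlim (\<lambda>n. ?h n *\<^sub>R b) (at 0) sequentially"
      using \<open>b \<noteq> 0\<close> by (simp add: filterlim_at)
    from filterlim_compose[OF lim this]
    have "(\<lambda>n. norm (u (x + ?h n *\<^sub>R b) - u x - D x (?h n *\<^sub>R b)) / norm (?h n *\<^sub>R b) * norm b) \<longlonglongrightarrow> 0"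
      by (rule tendsto_mult_left_zero)
    moreover have "norm (u (x + ?h n *\<^sub>R b) - u x - D x (?h n *\<^sub>R b)) / norm (?h n *\<^sub>R b) * norm b
      = norm (?q n x - D x b)" for n
    proof -
      have "D x (?h n *\<^sub>R b) = ?h n *\<^sub>R D x b"
        by (rule linear_scale[OF bounded_linear.linear[OF lin]])
      then have "?q n x - D x b = real (Suc n) *\<^sub>R (u (x + ?h n *\<^sub>R b) - u x - D x (?h n *\<^sub>R b))"
        using True by (simp add: scaleR_diff_right)
      then have "norm (?q n x - D x b) = real (Suc n) * norm (u (x + ?h n *\<^sub>R b) - u x - D x (?h n *\<^sub>R b))"
        by (simp only: norm_scaleR abs_of_nat)
      then show ?thesis
        using \<open>b \<noteq> 0\<close> by (simp add: divide_inverse)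
    qed
    ultimately have "(\<lambda>n. norm (?q n x - D x b)) \<longlonglongrightarrow> 0"
      by (simp only:)
    then have "(\<lambda>n. ?q n x) \<longlonglongrightarrow> D x b"
      by (simp only: tendsto_norm_zero_iff LIM_zero_iff)
    with True show ?thesis
      by (simp only: if_True)
  qed simp
qed

lemma has_vector_derivative_line:
  assumes "(u has_derivative D) (at x)"
  shows "((\<lambda>t. u (x + t *\<^sub>R b)) has_vector_derivative D b) (at 0)"
proof -
  have "((\<lambda>t. x + t *\<^sub>R b) has_vector_derivative b) (at 0)"
    by (auto intro!: derivative_eq_intros)
  moreover have "(u has_derivative D) (at (x + 0 *\<^sub>R b))"
    using assms by simp
  ultimately have "((u \<circ> (\<lambda>t. x + t *\<^sub>R b)) has_vector_derivative D b) (at 0)"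
    by (intro vector_derivative_diff_chain_within) (auto intro: has_derivative_at_withinI)
  then show ?thesis
    by (simp add: o_def)
qed

lemma in_LpI:
  assumes u: "u \<in> borel_measurable borel" and \<Omega>: "\<Omega> \<in> sets borel"
    and int: "integrable lborel (\<lambda>x. indicator \<Omega> x * norm (u x) powr p)"
  shows "in_Lp p \<Omega> u"
proof -
  have "u \<in> borel_measurable lebesgue"
    using u by (simp add: measurable_completion)
  then have "u \<in> borel_measurable (lebesgue_on \<Omega>)"
    by (rule measurable_restrict_space1)
  moreover have "(\<lambda>x. indicator \<Omega> x * norm (u x) powr p) \<in> borel_measurable lborel"
    using int by (rule borel_measurable_integrable)
  then have "integrable lebesgue (\<lambda>x. indicator \<Omega> x * norm (u x) powr p)"
    using int integrable_completion by blast
  then have "integrable (lebesgue_on \<Omega>) (\<lambda>x. norm (u x) powr p)"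
    using \<Omega> by (subst integrable_restrict_space) auto
  ultimately show ?thesis
    by (simp add: in_Lp_def)
qed

section \<open>Integrability of power singularities\<close>

abbreviation (input) square :: "(real \<times> real) set" where
  "square \<equiv> {-2<..<2} \<times> {-2<..<2}"

lemma square_infnorm: "{-2<..<2} \<times> {-2<..<2} = {x :: real \<times> real. infnorm x < 2}"
  by (auto simp: infnorm_pair)

lemma square_borel: "square \<in> sets borel"
  by (intro borel_open open_Times) auto

lemma integrable_indicator_square: "integrable lborel (\<lambda>x :: real \<times> real. indicator {x. infnorm x \<le> 2} x * c)" for c :: real
proof -
  have "{x :: real \<times> real. infnorm x \<le> 2} = cbox (-2, -2) (2, 2)"
    using cube_infnorm[of 0 2] cube_eq_cbox[of 0 2] by simp
  then show ?thesis
    by (intro integrable_mult_left integrable_real_indicator) (auto simp: emeasure_lborel_cbox_eq)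
qed

text \<open>The function \<open>\<bar>t\<bar> powr (- q)\<close> cut off at 4, which is the diameter
  of the square in the maximum norm. It is written as a sum of two one-sided functions, so that the
  reflection of one half gives integrability of the other. Its value at 0 is 0.\<close>

definition cut_powr :: "real \<Rightarrow> real \<Rightarrow> real" where
  "cut_powr q t = indicator {0<..4} t * t powr (- q) + indicator {0<..4} (- t) * (- t) powr (- q)"

lemma cut_powr_eq: "t \<noteq> 0 \<Longrightarrow> \<bar>t\<bar> \<le> 4 \<Longrightarrow> cut_powr q t = \<bar>t\<bar> powr (- q)"
  by (auto simp: cut_powr_def indicator_def abs_if)

lemma cut_powr_nonneg: "0 \<le> cut_powr q t"
  by (simp add: cut_powr_def)

lemma integrable_cut_powr:
  assumes "q < 1"
  shows "integrable lborel (cut_powr q)"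
proof -
  let ?f = "\<lambda>t :: real. indicator {0<..4} t * t powr (- q)"
  have "(\<lambda>t. t powr (- q)) integrable_on {0<..4}"
    using assms by (intro integrable_on_powr_from_0') auto
  then have "set_integrable lebesgue {0<..4} (\<lambda>t. t powr (- q))"
    by (intro nonnegative_absolutely_integrable_1) auto
  then have "integrable lebesgue ?f"
    by (simp add: set_integrable_def)
  then have f: "integrable lborel ?f"
    by (subst (asm) integrable_completion) auto
  from lborel_integrable_real_affine[OF f, of "-1" 0] show ?thesis
    unfolding cut_powr_def by (intro Bochner_Integration.integrable_add f) simp
qed

lemma integrable_cut_powr_product:
  assumes "q < 1"
  shows "integrable lborel (\<lambda>x :: real \<times> real. cut_powr q (fst x - a) * cut_powr q (snd x - b))"
proof -
  have shift: "integrable lborel (\<lambda>t. cut_powr q (t - c))" for c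
    using lborel_integrable_real_affine[OF integrable_cut_powr[OF assms], of 1 "- c"] by simp
  have "integrable (lborel \<Otimes>\<^sub>M lborel) (\<lambda>x :: real \<times> real. cut_powr q (fst x - a) * cut_powr q (snd x - b))"
  proof (rule lborel_pair.Fubini_integrable)
    have m: "cut_powr q \<in> borel_measurable borel"
      using borel_measurable_integrable[OF integrable_cut_powr[OF assms]] by simp
    show "(\<lambda>x :: real \<times> real. cut_powr q (fst x - a) * cut_powr q (snd x - b)) \<in> borel_measurable (lborel \<Otimes>\<^sub>M lborel)"
      unfolding lborel_prod measurable_lborel2
      by (intro borel_measurable_times measurable_compose[OF _ m] borel_measurable_continuous_onI continuous_intros)
    show "integrable lborel (\<lambda>x. LBINT y. norm (cut_powr q (fst (x, y) - a) * cut_powr q (snd (x, y) - b)))"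
      using shift by (simp add: abs_mult cut_powr_nonneg)
    show "AE x in lborel. integrable lborel (\<lambda>y. cut_powr q (fst (x, y) - a) * cut_powr q (snd (x, y) - b))"
      using shift by simp
  qed
  then show ?thesis
    by (simp add: lborel_prod)
qed

text \<open>The maximum of two numbers dominates their geometric mean. This reduces the integrability of
  the singularity in the plane to the one of \<open>\<bar>t\<bar> powr (- p / 2)\<close> on the line.\<close>

lemma infnorm_powr_le:
  assumes "fst x \<noteq> fst s" "snd x \<noteq> snd s" "infnorm (x - s) \<le> 4" "0 \<le> q"
  shows "infnorm (x - s) powr (- (2 * q)) \<le> cut_powr q (fst x - fst s) * cut_powr q (snd x - snd s)"
proof -
  let ?N = "infnorm (x - s)"
  have N: "\<bar>fst x - fst s\<bar> \<le> ?N" "\<bar>snd x - snd s\<bar> \<le> ?N"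
    using infnorm_pair[of "x - s"] by simp_all
  have "?N powr (- (2 * q)) = ?N powr (- q) * ?N powr (- q)"
    by (simp flip: powr_add)
  also have "\<dots> \<le> \<bar>fst x - fst s\<bar> powr (- q) * \<bar>snd x - snd s\<bar> powr (- q)"
    using assms N by (intro mult_mono powr_mono2') auto
  also have "\<dots> = cut_powr q (fst x - fst s) * cut_powr q (snd x - snd s)"
    using assms N by (subst (1 2) cut_powr_eq) auto
  finally show ?thesis .
qed

text \<open>The pole that controls \<open>w x\<close> may vary with \<open>x\<close>, so the
  dominating function sums over all of them. As \<open>cut_powr\<close> is 0 at 0, a product
  dominates only off the two axis-parallel lines through its pole; hence the conditions on the
  coordinates.\<close>

lemma integrable_powr_singular:
  fixes w :: "real \<times> real \<Rightarrow> 'b::euclidean_space"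
  assumes p: "1 \<le> p" "p < 2" and w: "w \<in> borel_measurable borel" and S: "finite S"
    and outside: "\<And>x. 2 < infnorm x \<Longrightarrow> w x = 0"
    and bound: "\<And>x. infnorm x \<le> 2 \<Longrightarrow> w x \<noteq> 0 \<Longrightarrow>
      \<exists>s\<in>S. fst x \<noteq> fst s \<and> snd x \<noteq> snd s \<and> infnorm s \<le> 2 \<and> norm (w x) \<le> C / infnorm (x - s)"
  shows "integrable lborel (\<lambda>x. norm (w x) powr p)"
proof (rule Bochner_Integration.integrable_bound)
  let ?P = "\<lambda>s x. cut_powr (p/2) (fst x - fst s) * cut_powr (p/2) (snd x - snd s)"
  show "integrable lborel (\<lambda>x. C powr p * (\<Sum>s\<in>S. ?P s x))"
    using p by (intro integrable_mult_right Bochner_Integration.integrable_sum integrable_cut_powr_product) auto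
  have nonneg: "0 \<le> ?P s x" for s x
    by (simp add: cut_powr_nonneg)
  have "norm (w x) powr p \<le> C powr p * (\<Sum>s\<in>S. ?P s x)" for x
  proof (cases "w x = 0")
    case True
    then show ?thesis
      using p nonneg by (simp add: sum_nonneg)
  next
    case False
    then have x: "infnorm x \<le> 2"
      using outside[of x] by (cases "infnorm x \<le> 2") auto
    obtain s where s: "s \<in> S" "fst x \<noteq> fst s" "snd x \<noteq> snd s" "infnorm s \<le> 2" "norm (w x) \<le> C / infnorm (x - s)"
      using bound[OF x False] by blast
    have le4: "infnorm (x - s) \<le> 4"
      using infnorm_triangle[of x "- s"] x s(4) by (simp add: infnorm_neg)
    have pos: "0 < infnorm (x - s)"
      using s(2) by (auto simp: infnorm_pos_lt)
    have "0 < norm (w x)"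
      using False by simp
    then have "0 < C"
      using s(5) pos by (smt (verit) divide_nonpos_pos)
    have "norm (w x) powr p \<le> (C / infnorm (x - s)) powr p"
      using s(5) p by (intro powr_mono2) auto
    also have "\<dots> = C powr p * infnorm (x - s) powr (- (2 * (p / 2)))"
      using \<open>0 < C\<close> pos by (simp add: powr_divide powr_minus_divide)
    also have "\<dots> \<le> C powr p * ?P s x"
      using s le4 p by (intro mult_left_mono infnorm_powr_le) auto
    also have "\<dots> \<le> C powr p * (\<Sum>s\<in>S. ?P s x)"
      using s(1) S nonneg by (intro mult_left_mono member_le_sum) auto
    finally show ?thesis .
  qed
  then show "AE x in lborel. norm (norm (w x) powr p) \<le> norm (C powr p * (\<Sum>s\<in>S. ?P s x))"
    by (intro AE_I2) (smt (verit) powr_ge_zero real_norm_def)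
qed (use w in measurable)

lemma bounded_powr_integrable:
  fixes u :: "real \<times> real \<Rightarrow> 'b::euclidean_space"
  assumes p: "0 \<le> p" and u [measurable]: "u \<in> borel_measurable borel"
    and "\<And>x. infnorm x \<le> 2 \<Longrightarrow> norm (u x) \<le> C"
    and \<Omega>: "\<Omega> \<in> sets borel" "\<And>x. x \<in> \<Omega> \<Longrightarrow> 2 < infnorm x \<Longrightarrow> norm (u x) powr p = 0"
  shows "integrable lborel (\<lambda>x. indicator \<Omega> x * norm (u x) powr p)"
proof (rule Bochner_Integration.integrable_bound[OF integrable_indicator_square[of "C powr p"]])
  show "(\<lambda>x. indicator \<Omega> x * norm (u x) powr p) \<in> borel_measurable lborel"
    using \<Omega>(1) by measurable
  show "AE x in lborel. norm (indicator \<Omega> x * norm (u x) powr p)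
      \<le> norm (indicator {x. infnorm x \<le> 2} x * C powr p)"
  proof (rule AE_I2)
    fix x :: "real \<times> real"
    show "norm (indicator \<Omega> x * norm (u x) powr p) \<le> norm (indicator {x. infnorm x \<le> 2} x * C powr p)"
    proof (cases "infnorm x \<le> 2")
      case True
      then have "norm (u x) powr p \<le> C powr p"
        using assms by (intro powr_mono2) auto
      then show ?thesis
        using True by (simp add: indicator_def)
    next
      case False
      then show ?thesis
        using \<Omega>(2)[of x] by (simp add: indicator_def)
    qed
  qed
qed

section \<open>The map\<close>

text \<open>The minimum makes \<open>rho\<close> the identity outside the square: one formula covers
  the radial retraction and its extension, continuous off 0.\<close>

definition rho :: "real \<times> real \<Rightarrow> real \<times> real" where
  "rho w = (2 / min 2 (infnorm w)) *\<^sub>R w"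

text \<open>The set where \<open>\<bar>fst v\<bar> < lens v\<close> is the open rhombus with
  vertices \<open>(0, 0)\<close>, \<open>(1, 1)\<close>, \<open>(0, 2)\<close> and
  \<open>(-1, 1)\<close>, as the maximum norm there equals \<open>snd v\<close>. The function
  vanishes outside the square and on the lower half-plane.\<close>

definition lens :: "real \<times> real \<Rightarrow> real" where
  "lens v = max 0 (min (snd v) (2 - infnorm v))"

text \<open>The lens between the origin and \<open>(0, 2)\<close> is collapsed horizontally onto the vertical axis. So \<open>rho \<circ> outer_map\<close>
  has the value \<open>(0, 2)\<close> there, which makes room for the dipole of the poles \<open>ptA\<close> and \<open>ptB\<close>.\<close>

definition outer_map :: "real \<times> real \<Rightarrow> real \<times> real" where
  "outer_map v = (max 0 (fst v - lens v) - max 0 (- fst v - lens v), snd v)"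

text \<open>For fixed \<open>T > 0\<close> the curve \<open>u \<mapsto> fold_map (u, T)\<close>, \<open>\<bar>u\<bar> \<le> T\<close>, runs once counterclockwise around the
  origin along a rhombus, from and to the positive vertical half-axis, where it stays for \<open>\<bar>u\<bar> \<ge> T\<close>. It is homogeneous of degree 1.\<close>

definition fold_map :: "real \<times> real \<Rightarrow> real \<times> real" where
  "fold_map = (\<lambda>(u, T). (max 0 (min u (T - u)) - max 0 (min (- u) (T + u)), \<bar>u\<bar> - T / 2))"

text \<open>Arguments \<open>(u, T)\<close> for \<open>fold_map\<close>: up to height 9/8 these are
  coordinates centred at \<open>ptA\<close>, above it coordinates centred at \<open>ptB\<close> with
  the vertical direction reversed, whence the opposite local degrees. The condition
  \<open>\<bar>u\<bar> \<le> T\<close> describes the rhombus with opposite vertices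
  \<open>ptA\<close> and \<open>ptB\<close>; 3/8 is half their distance.\<close>

definition dipole :: "real \<times> real \<Rightarrow> real \<times> real" where
  "dipole v = (fst v + 1/4, 3/8 - \<bar>snd v - 9/8\<bar>)"

definition inner_map :: "real \<times> real \<Rightarrow> real \<times> real" where
  "inner_map v = fold_map (dipole v)"

definition cav :: "real \<times> real \<Rightarrow> real \<times> real" where
  "cav v = rho (if \<bar>fst v\<bar> < lens v then inner_map v else outer_map v)"

definition ptA :: "real \<times> real" where "ptA = (-1/4, 3/4)"
definition ptB :: "real \<times> real" where "ptB = (-1/4, 3/2)"
definition sing :: "(real \<times> real) set" where "sing = {0, ptA, ptB}"

section \<open>Homogeneity, size estimates and the gluing of the two formulas\<close>

lemma rho_small: "infnorm w \<le> 2 \<Longrightarrow> rho w = (2 / infnorm w) *\<^sub>R w"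
  by (simp add: rho_def min_absorb2)

lemma rho_scale:
  assumes "0 < c" "infnorm w \<le> 2" "infnorm (c *\<^sub>R w) \<le> 2"
  shows "rho (c *\<^sub>R w) = rho w"
  using assms by (simp add: rho_small) (simp add: infnorm_mul)

lemma infnorm_rho: "w \<noteq> 0 \<Longrightarrow> infnorm w \<le> 2 \<Longrightarrow> infnorm (rho w) = 2"
  using infnorm_pos_lt[of w] by (simp add: rho_small infnorm_mul)

lemma rho_vertical: "0 < t \<Longrightarrow> t \<le> 2 \<Longrightarrow> rho (0, t) = (0, 2)"
  by (simp add: rho_def infnorm_pair)

lemma fold_map_scale:
  assumes "0 \<le> c"
  shows "fold_map (c *\<^sub>R w) = c *\<^sub>R fold_map w"
proof -
  have tri: "max 0 (min (c * u) (c * S)) = c * max 0 (min u S)" for u S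
    using assms by (simp add: max_mult_distrib_left min_mult_distrib_left)
  obtain u T where w: "w = (u, T)"
    by fastforce
  show ?thesis
    using tri[of u "T - u"] tri[of "- u" "T + u"] assms
    by (simp only: w fold_map_def scaleR_Pair real_scaleR_def prod.case right_diff_distrib
        distrib_left mult_minus_right abs_mult abs_of_nonneg times_divide_eq_right)
qed

lemma fold_map_fst: "\<bar>fst (fold_map (u, T))\<bar> \<le> \<bar>u\<bar>"
  by (auto simp: fold_map_def max_def min_def abs_if)

lemma fold_map_snd: "snd (fold_map (u, T)) = \<bar>u\<bar> - T / 2"
  by (simp add: fold_map_def)

lemma fold_map_outside: "T < \<bar>u\<bar> \<Longrightarrow> fold_map (u, T) = (0, \<bar>u\<bar> - T/2) \<and> 0 < \<bar>u\<bar> - T/2"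
  by (auto simp: fold_map_def max_def min_def abs_if)

lemma fold_map_inside: "\<bar>u\<bar> \<le> T \<Longrightarrow> \<bar>fst (fold_map (u, T))\<bar> = min \<bar>u\<bar> (T - \<bar>u\<bar>)"
  by (cases "0 \<le> u") (simp_all add: fold_map_def)

lemma fold_map_bound:
  assumes "\<bar>u\<bar> \<le> 5/4" "T \<le> 3/8" "- 3/4 \<le> T"
  shows "infnorm (fold_map (u, T)) \<le> 2"
proof -
  have "\<bar>\<bar>u\<bar> - T / 2\<bar> \<le> 2" "\<bar>u\<bar> \<le> 2"
    using assms by linarith+
  then show ?thesis
    unfolding infnorm_pair fold_map_snd by (meson fold_map_fst max.boundedI order.trans)
qed

lemma lens_pos_iff: "0 < lens v \<longleftrightarrow> 0 < snd v \<and> infnorm v < 2"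
  by (auto simp: lens_def less_max_iff_disj)

lemma le_lens_iff: "0 < lens v \<Longrightarrow> c \<le> lens v \<longleftrightarrow> c \<le> snd v \<and> c + infnorm v \<le> 2"
  unfolding lens_pos_iff by (auto simp: lens_def le_max_iff_disj)

lemma lens_pos:
  assumes "0 < lens v"
  shows "0 < snd v \<and> snd v < 2 \<and> infnorm v < 2"
proof -
  have "0 < snd v" "infnorm v < 2"
    using assms by (auto simp only: lens_pos_iff)
  then show ?thesis
    by (simp add: infnorm_pair)
qed

lemma dipole_bound:
  assumes "\<bar>fst v\<bar> \<le> lens v" "0 < lens v"
  shows "infnorm (inner_map v) \<le> 2"
proof -
  have "\<bar>fst v\<bar> \<le> snd v" "snd v \<le> 2 - \<bar>fst v\<bar>"
    using assms lens_pos[OF assms(2)] unfolding le_lens_iff[OF assms(2)] infnorm_pair by auto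
  then have "\<bar>fst v + 1/4\<bar> \<le> 5/4" "- 3/4 \<le> 3/8 - \<bar>snd v - 9/8\<bar>"
    by linarith+
  then show ?thesis
    unfolding inner_map_def dipole_def using fold_map_bound by simp
qed

lemma lens_le: "lens v \<le> \<bar>snd v\<bar>" "0 \<le> lens v"
  by (auto simp: lens_def)

lemma fst_outer: "\<bar>fst (outer_map v)\<bar> = max 0 (\<bar>fst v\<bar> - lens v)"
  using lens_le(2)[of v] by (cases "0 \<le> fst v") (simp_all add: outer_map_def)

text \<open>Since \<open>lens v \<le> \<bar>snd v\<bar>\<close>, the moduli of the two coordinates
  of the image add up to at least \<open>\<bar>fst v\<bar>\<close>; so the collapse shrinks the norm
  by a factor of at most 2.\<close>

lemma outer_lower: "infnorm v \<le> 2 * infnorm (outer_map v)"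
proof -
  have "\<bar>fst v\<bar> - \<bar>snd v\<bar> \<le> \<bar>fst (outer_map v)\<bar>" "snd (outer_map v) = snd v"
    using lens_le(1)[of v] by (simp_all add: fst_outer, simp add: outer_map_def)
  then show ?thesis
    by (cases "\<bar>fst v\<bar> \<le> \<bar>snd v\<bar>") (simp_all add: infnorm_pair)
qed

lemma outer_bound: "infnorm v \<le> 2 \<Longrightarrow> infnorm (outer_map v) \<le> 2"
  using lens_le(2)[of v] by (simp add: infnorm_pair fst_outer) (simp add: outer_map_def)

lemma outer_out: "2 \<le> infnorm v \<Longrightarrow> outer_map v = v"
  unfolding outer_map_def lens_def by (cases v) (auto simp: max_def)

text \<open>For \<open>\<bar>u\<bar> \<le> T\<close> the coordinates have moduli
  \<open>T / 2 - d\<close> and \<open>d\<close> with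
  \<open>d = \<bar>\<bar>u\<bar> - T / 2\<bar>\<close>, and the larger of these is at least
  \<open>T / 4\<close>. Such linear lower bounds turn \<open>1 / infnorm (K x)\<close> into the
  inverse distance to a pole.\<close>

lemma fold_map_lower: "max \<bar>u\<bar> \<bar>T\<bar> \<le> 4 * infnorm (fold_map (u, T))"
proof (cases "\<bar>u\<bar> \<le> T")
  case True
  have "T \<le> 4 * max (min a (T - a)) \<bar>a - T / 2\<bar>" for a
    by (simp add: max_def min_def abs_if)
  from this[of "\<bar>u\<bar>"] have "T \<le> 4 * infnorm (fold_map (u, T))"
    by (simp only: fold_map_inside[OF True] fold_map_snd infnorm_pair)
  with True show ?thesis
    by simp
next
  case False
  then show ?thesis
    using fold_map_outside[of T u] by (simp add: infnorm_pair)
qed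

lemma dipole_A: "snd v \<le> 9/8 \<Longrightarrow> dipole v = v - ptA"
  and dipole_B: "9/8 \<le> snd v \<Longrightarrow> dipole v = (fst (v - ptB), - snd (v - ptB))"
  by (cases v, simp add: dipole_def ptA_def ptB_def)+

lemma inner_lower_A: "snd v \<le> 9/8 \<Longrightarrow> infnorm (v - ptA) \<le> 4 * infnorm (inner_map v)"
  using fold_map_lower[of "fst (v - ptA)" "snd (v - ptA)"]
  by (simp only: inner_map_def dipole_A infnorm_pair[of "v - _"] prod.collapse)

lemma inner_lower_B: "9/8 \<le> snd v \<Longrightarrow> infnorm (v - ptB) \<le> 4 * infnorm (inner_map v)"
  using fold_map_lower[of "fst (v - ptB)" "- snd (v - ptB)"]
  by (simp only: inner_map_def dipole_B infnorm_pair[of "v - _"] abs_minus_cancel)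

text \<open>The closed rhombus of the dipole lies in the open lens, which leaves a collar between
  them where both formulas give \<open>(0, 2)\<close>.\<close>

lemma dipole_in_lens:
  assumes "\<bar>fst (dipole v)\<bar> \<le> snd (dipole v)"
  shows "\<bar>fst v\<bar> < lens v"
proof -
  obtain x y where v: "v = (x, y)"
    by fastforce
  have "x + y \<le> 5/4" "x - y \<le> - 1" "- x + y \<le> 7/4" "- x - y \<le> - 1/2"
    using assms by (simp_all add: v dipole_def)
  then have "\<bar>x\<bar> < y" "\<bar>x\<bar> + y < 2"
    by linarith+
  then show ?thesis
    by (simp add: v lens_def infnorm_pair)
qed

lemma outer_map_lens:
  "\<bar>fst v\<bar> \<le> lens v \<Longrightarrow> outer_map v = (0, snd v)"
  by (simp add: outer_map_def)

lemma inner_map_outside: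
  assumes "snd (dipole v) < \<bar>fst (dipole v)\<bar>" "\<bar>fst v\<bar> \<le> lens v" "0 < lens v"
  shows "rho (inner_map v) = (0, 2)"
proof -
  obtain t where t: "inner_map v = (0, t)" "0 < t"
    using fold_map_outside[of "snd (dipole v)" "fst (dipole v)"] assms by (simp add: inner_map_def)
  moreover have "t \<le> 2"
    using dipole_bound[OF assms(2,3)] t by (simp add: infnorm_pair)
  ultimately show ?thesis
    by (simp add: rho_vertical)
qed

lemma rho_outer_lens:
  assumes "\<bar>fst v\<bar> \<le> lens v" "0 < lens v"
  shows "rho (outer_map v) = (0, 2)"
  using assms lens_pos[of v] by (simp add: outer_map_lens rho_vertical)

text \<open>On the edge of the lens \<open>cav\<close> is defined through \<open>outer_map\<close>;
  but the edge does not meet the rhombus of the dipole, so both formulas have the value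
  \<open>(0, 2)\<close> there.\<close>

lemma cav_inner:
  assumes "\<bar>fst v\<bar> \<le> lens v" "0 < lens v"
  shows "cav v = rho (inner_map v)"
proof (cases "\<bar>fst v\<bar> < lens v")
  case False
  then have "snd (dipole v) < \<bar>fst (dipole v)\<bar>"
    using dipole_in_lens[of v] by linarith
  with False show ?thesis
    using inner_map_outside[OF _ assms] rho_outer_lens[OF assms] by (simp add: cav_def)
qed (simp add: cav_def)

lemma cav_outer:
  assumes "snd (dipole v) < \<bar>fst (dipole v)\<bar>"
  shows "cav v = rho (outer_map v)"
  using inner_map_outside[OF assms] rho_outer_lens[of v]
  by (cases "\<bar>fst v\<bar> < lens v") (auto simp: cav_def)

lemma rho_zero [simp]: "rho 0 = 0"
  by (simp add: rho_def)

section \<open>Continuity off the poles and values on the square\<close>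

lemma continuous_on_rho: "continuous_on (- {0}) rho"
  unfolding rho_def
  by (intro continuous_intros) (auto simp: infnorm_eq_0 min_def infnorm_pos_lt)

lemma rho_outside: "2 \<le> infnorm w \<Longrightarrow> rho w = w"
  by (simp add: rho_def)

lemma continuous_on_fold_map: "continuous_on S fold_map"
  unfolding fold_map_def split_def by (intro continuous_intros) auto

lemma continuous_on_dipole: "continuous_on S dipole"
  unfolding dipole_def by (intro continuous_intros)

lemma continuous_on_inner_map: "continuous_on S inner_map"
  unfolding inner_map_def
  by (rule continuous_on_compose2[OF continuous_on_fold_map[of UNIV] continuous_on_dipole]) simp

lemma continuous_on_lens: "continuous_on S lens"
  unfolding lens_def by (intro continuous_intros)

lemma continuous_on_outer_map: "continuous_on S outer_map"
  unfolding outer_map_def by (intro continuous_intros continuous_on_lens)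

definition inner_dom :: "(real \<times> real) set" where
  "inner_dom = {v. \<bar>fst v\<bar> < lens v}"

text \<open>The complement of the closed rhombus of the dipole, not of the lens. It is open,
  overlaps \<open>inner_dom\<close>, and together with it covers the plane, so every local property
  of \<open>cav\<close> concerns only one of the two formulas.\<close>

definition outer_dom :: "(real \<times> real) set" where
  "outer_dom = {v. snd (dipole v) < \<bar>fst (dipole v)\<bar>}"

lemma open_inner_dom: "open inner_dom"
  unfolding inner_dom_def by (intro open_Collect_less continuous_intros continuous_on_lens)

lemma open_outer_dom: "open outer_dom"
  unfolding outer_dom_def by (intro open_Collect_less continuous_intros continuous_on_dipole)

lemma dom_cover: "v \<in> inner_dom \<or> v \<in> outer_dom"
  using dipole_in_lens[of v] by (auto simp: inner_dom_def outer_dom_def)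

lemma inner_dom_pos: "v \<in> inner_dom \<Longrightarrow> \<bar>fst v\<bar> \<le> lens v \<and> 0 < lens v"
  by (auto simp: inner_dom_def)

lemma cav_inner_dom: "v \<in> inner_dom \<Longrightarrow> cav v = rho (inner_map v)"
  by (simp add: cav_inner inner_dom_pos)

lemma cav_outer_dom: "v \<in> outer_dom \<Longrightarrow> cav v = rho (outer_map v)"
  by (simp add: cav_outer outer_dom_def)

lemma inner_map_eq_0: "inner_map v = 0 \<Longrightarrow> v = ptA \<or> v = ptB"
  using inner_lower_A[of v] inner_lower_B[of v] infnorm_pos_lt[of "v - ptA"] infnorm_pos_lt[of "v - ptB"]
  by (cases "snd v \<le> 9/8") (auto simp: infnorm_0)

lemma outer_map_eq_0: "outer_map v = 0 \<Longrightarrow> v = 0"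
  using outer_lower[of v] infnorm_pos_lt[of v] by (auto simp: infnorm_0)

lemma open_Compl_sing: "open (- sing)"
  by (auto simp: sing_def intro!: open_Compl finite_imp_closed)

lemma continuous_on_cav: "continuous_on (- sing) cav"
proof -
  have "continuous_on (- sing \<inter> inner_dom) cav"
    by (subst continuous_on_cong[OF refl, where g = "\<lambda>v. rho (inner_map v)"])
      (auto simp: cav_inner_dom sing_def intro!: continuous_on_compose2[OF continuous_on_rho continuous_on_inner_map]
        dest: inner_map_eq_0)
  moreover have "continuous_on (- sing \<inter> outer_dom) cav"
    by (subst continuous_on_cong[OF refl, where g = "\<lambda>v. rho (outer_map v)"])
      (auto simp: cav_outer_dom sing_def intro!: continuous_on_compose2[OF continuous_on_rho continuous_on_outer_map]
        dest: outer_map_eq_0)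
  ultimately have "continuous_on ((- sing \<inter> inner_dom) \<union> (- sing \<inter> outer_dom)) cav"
    by (intro continuous_on_open_Un open_Int open_Compl_sing open_inner_dom open_outer_dom)
  moreover have "(- sing \<inter> inner_dom) \<union> (- sing \<inter> outer_dom) = - sing"
    using dom_cover by auto
  ultimately show ?thesis
    by simp
qed

lemma cav_outside:
  assumes "2 \<le> infnorm v"
  shows "cav v = v"
proof -
  have "lens v = 0"
    using assms by (simp add: lens_def)
  then show ?thesis
    using assms by (simp add: cav_def outer_out rho_outside)
qed

lemma infnorm_cav:
  assumes "infnorm v \<le> 2" "v \<notin> sing"
  shows "infnorm (cav v) = 2"
proof (cases "v \<in> inner_dom")
  case True
  moreover have "inner_map v \<noteq> 0"
    using assms(2) inner_map_eq_0[of v] by (auto simp: sing_def)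
  ultimately show ?thesis
    using dipole_bound[of v] inner_dom_pos[OF True] by (simp add: cav_inner_dom infnorm_rho)
next
  case False
  then have "v \<in> outer_dom"
    using dom_cover by blast
  moreover have "outer_map v \<noteq> 0"
    using assms(2) outer_map_eq_0[of v] by (auto simp: sing_def)
  ultimately show ?thesis
    using outer_bound[OF assms(1)] by (simp add: cav_outer_dom infnorm_rho)
qed

lemma infnorm_cav_le:
  assumes "infnorm v \<le> 2"
  shows "infnorm (cav v) \<le> 2"
proof (cases "v \<in> sing")
  case True
  have "cav v = 0 \<or> infnorm (cav v) \<le> 2"
    using assms dipole_bound[of v] outer_bound[of v] infnorm_rho[of "inner_map v"] infnorm_rho[of "outer_map v"]
      inner_dom_pos[of v] dom_cover[of v] cav_inner_dom[of v] cav_outer_dom[of v]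
    by (metis order_refl rho_zero)
  then show ?thesis
    by (auto simp: infnorm_0)
qed (simp add: infnorm_cav assms)

section \<open>Level sets of the map in cubes without poles\<close>

lemma inner_map_scale_A:
  assumes "snd v \<le> 9/8" "0 \<le> c" "c \<le> 1"
  shows "inner_map (ptA + c *\<^sub>R (v - ptA)) = c *\<^sub>R inner_map v"
proof -
  let ?w = "ptA + c *\<^sub>R (v - ptA)"
  have "c * (snd v - 3/4) \<le> c * (3/8)"
    using assms by (intro mult_left_mono) auto
  also have "\<dots> \<le> 3/8"
    using assms by simp
  finally have "snd ?w \<le> 9/8"
    by (simp add: ptA_def)
  then show ?thesis
    using assms by (simp add: inner_map_def dipole_A fold_map_scale)
qed

lemma inner_map_scale_B:
  assumes "9/8 \<le> snd v" "0 \<le> c" "c \<le> 1"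
  shows "inner_map (ptB + c *\<^sub>R (v - ptB)) = c *\<^sub>R inner_map v"
proof -
  let ?w = "ptB + c *\<^sub>R (v - ptB)"
  have "c * (3/2 - snd v) \<le> c * (3/8)"
    using assms by (intro mult_left_mono) auto
  also have "\<dots> \<le> 3/8"
    using assms by simp
  finally have "9/8 \<le> snd ?w"
    by (simp add: ptB_def algebra_simps)
  then show ?thesis
    using assms fold_map_scale[OF assms(2), of "(fst (v - ptB), - snd (v - ptB))"]
    by (simp add: inner_map_def dipole_B minus_mult_right)
qed

lemma outer_map_scale:
  assumes "snd v + infnorm v \<le> 2" "0 \<le> c" "c \<le> 1"
  shows "outer_map (c *\<^sub>R v) = c *\<^sub>R outer_map v"
proof -
  have "c * (snd v + infnorm v) \<le> 1 * 2"
    using assms infnorm_pos_le[of v] by (intro order.trans[OF mult_left_mono[OF assms(1)]]) auto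
  then have "snd (c *\<^sub>R v) + infnorm (c *\<^sub>R v) \<le> 2"
    using assms by (simp add: infnorm_mul distrib_left)
  moreover have lens: "lens w = max 0 (snd w)" if "snd w + infnorm w \<le> 2" for w
    using that by (simp add: lens_def)
  ultimately have "lens (c *\<^sub>R v) = c * lens v"
    using assms by (simp add: max_mult_distrib_left)
  then show ?thesis
    using assms(2) max_mult_distrib_left[of c 0 "fst v - lens v"] max_mult_distrib_left[of c 0 "- fst v - lens v"]
    by (simp add: outer_map_def right_diff_distrib)
qed

text \<open>Moving towards a pole along a segment does not change the value of \<open>rho \<circ> inner_map\<close>, and such
  a segment leaves every cube that contains no pole.\<close>

lemma cav_frontier_inner:
  assumes R: "closed R" "R \<subseteq> inner_dom" "R \<inter> sing = {}" and x: "x \<in> R"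
  shows "cav x \<in> cav ` frontier R"
proof -
  have key: "cav x \<in> cav ` frontier R"
    if p: "p \<in> sing" and scale: "\<And>c. 0 \<le> c \<Longrightarrow> c \<le> 1 \<Longrightarrow> inner_map (p + c *\<^sub>R (x - p)) = c *\<^sub>R inner_map x" for p
  proof -
    have "p \<notin> R"
      using p R by auto
    then obtain c where c: "0 < c" "c \<le> 1" "p + c *\<^sub>R (x - p) \<in> frontier R"
      using segment_hits_frontier[OF _ x R(1)] by metis
    let ?z = "p + c *\<^sub>R (x - p)"
    have "?z \<in> inner_dom" "x \<in> inner_dom"
      using c frontier_subset_closed[OF R(1)] R x by auto
    moreover have "inner_map ?z = c *\<^sub>R inner_map x"
      using c by (intro scale) auto
    ultimately have "cav ?z = cav x"
      using dipole_bound[of x] dipole_bound[of ?z] inner_dom_pos c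
      by (metis cav_inner_dom rho_scale)
    with c show ?thesis
      by (metis image_eqI)
  qed
  show ?thesis
  proof (cases "snd x \<le> 9/8")
    case True
    then show ?thesis
      by (intro key[of ptA] inner_map_scale_A) (auto simp: sing_def)
  next
    case False
    then show ?thesis
      by (intro key[of ptB] inner_map_scale_B) (auto simp: sing_def)
  qed
qed

lemma lens_decreasing: "\<bar>fst p\<bar> \<le> \<bar>fst q\<bar> \<Longrightarrow> snd p = snd q \<Longrightarrow> lens q \<le> lens p"
  unfolding lens_def infnorm_pair by (intro max.mono min.mono diff_mono order_refl) simp_all

lemma snd_outer_map [simp]: "snd (outer_map v) = snd v"
  by (simp add: outer_map_def)

lemma fst_outer_map_nonneg: "0 \<le> fst v \<Longrightarrow> fst (outer_map v) = max 0 (fst v - lens v)"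
  and fst_outer_map_nonpos: "fst v \<le> 0 \<Longrightarrow> fst (outer_map v) = - max 0 (- fst v - lens v)"
  using lens_le(2)[of v] by (simp_all add: outer_map_def)

lemma outer_map_mono:
  assumes "snd p = snd q" "fst p \<le> fst q"
  shows "fst (outer_map p) \<le> fst (outer_map q)"
proof -
  consider "0 \<le> fst p" "0 \<le> fst q" | "fst p \<le> 0" "0 \<le> fst q" | "fst p \<le> 0" "fst q \<le> 0"
    using assms by linarith
  then show ?thesis
  proof cases
    case 1
    then show ?thesis
      using assms lens_decreasing[of p q] by (simp only: fst_outer_map_nonneg) (intro max.mono diff_mono; simp)
  next
    case 2
    have "- max 0 (- fst p - lens p) \<le> 0" "0 \<le> max 0 (fst q - lens q)"
      by simp_all
    with 2 show ?thesis
      by (simp only: fst_outer_map_nonneg fst_outer_map_nonpos)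
  next
    case 3
    then show ?thesis
      using assms lens_decreasing[of q p] by (simp only: fst_outer_map_nonpos neg_le_iff_le) (intro max.mono diff_mono; simp)
  qed
qed

text \<open>Off the horizontal axis the direction of \<open>outer_map v\<close> is determined by the
  sign of \<open>snd v\<close> and the slope \<open>fst (outer_map v) / \<bar>snd v\<bar>\<close>,
  which is monotone along rows. At the axis the slope is undefined, but there
  \<open>outer_map\<close> is homogeneous, so that segments towards the origin are level.\<close>

lemma cav_frontier_outer:
  assumes r: "0 < r" and R: "cube a r \<subseteq> outer_dom" "0 \<notin> cube a r" "\<And>x. x \<in> cube a r \<Longrightarrow> infnorm x \<le> 2"
    and pos: "(\<forall>x\<in>cube a r. snd x \<noteq> 0) \<or> (\<forall>x\<in>cube a r. snd x + infnorm x \<le> 2)"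
    and x: "x \<in> cube a r"
  shows "cav x \<in> cav ` frontier (cube a r)"
proof -
  have sub: "frontier (cube a r) \<subseteq> cube a r"
    by (rule frontier_subset_closed[OF closed_cube])
  have eq: "cav z = cav x" if "z \<in> frontier (cube a r)" "0 < c" "outer_map z = c *\<^sub>R outer_map x" for z c
  proof -
    have "z \<in> cube a r"
      using that sub by auto
    then have "infnorm (outer_map z) \<le> 2" "infnorm (outer_map x) \<le> 2" "cav z = rho (outer_map z)" "cav x = rho (outer_map x)"
      using R(1) R(3)[of z] R(3)[OF x] x by (auto intro!: outer_bound cav_outer_dom)
    then show ?thesis
      using that rho_scale by metis
  qed
  show ?thesis
    using pos
  proof
    assume nz: "\<forall>x\<in>cube a r. snd x \<noteq> 0"
    define m where "m v = fst (outer_map v) / \<bar>snd v\<bar>" for v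
    obtain z where z: "z \<in> frontier (cube a r)" "m z = m x"
    proof (rule mono_hits_frontier[OF r _ x])
      show "continuous_on (cube a r) m"
        unfolding m_def using nz by (intro continuous_intros continuous_on_outer_map) auto
      show "m p \<le> m q" if "snd p = snd q" "fst p \<le> fst q" for p q
        unfolding m_def that(1) by (intro divide_right_mono outer_map_mono that) simp
    qed
    have zx: "snd z \<noteq> 0" "snd x \<noteq> 0"
      using z(1) sub x nz by auto
    \<comment> \<open>The cube lies strictly on one side of the axis, so \<open>snd z\<close> and
      \<open>snd x\<close> have the same sign and equal slopes mean equal directions.\<close>
    have "(fst a, 0) \<notin> cube a r"
      using nz by force
    then have "r < \<bar>snd a\<bar>"
      using r by (simp add: cube_infnorm infnorm_pair)
    moreover have "\<bar>snd z - snd a\<bar> \<le> r" "\<bar>snd x - snd a\<bar> \<le> r"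
      using z(1) sub x by (auto simp: cube_infnorm infnorm_pair)
    ultimately have "0 < snd z \<longleftrightarrow> 0 < snd x"
      by linarith
    then have "snd z / snd x = \<bar>snd z\<bar> / \<bar>snd x\<bar>"
      using zx by (auto simp: abs_if divide_simps)
    moreover from this have "0 < snd z / snd x"
      using zx by simp
    moreover have "fst (outer_map z) = (\<bar>snd z\<bar> / \<bar>snd x\<bar>) * fst (outer_map x)"
      using z(2) zx by (simp add: m_def divide_simps mult.commute)
    moreover have "snd (outer_map z) = (snd z / snd x) * snd (outer_map x)"
      using zx by simp
    ultimately have "outer_map z = (snd z / snd x) *\<^sub>R outer_map x"
      by (simp only: prod_eq_iff fst_scaleR snd_scaleR real_scaleR_def)
    with \<open>0 < snd z / snd x\<close> have "cav z = cav x"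
      by (intro eq[OF z(1)])
    then show ?thesis
      using z(1) by (metis image_eqI)
  next
    assume near: "\<forall>x\<in>cube a r. snd x + infnorm x \<le> 2"
    obtain c where c: "0 < c" "c \<le> 1" "0 + c *\<^sub>R (x - 0) \<in> frontier (cube a r)"
      using segment_hits_frontier[OF R(2) x closed_cube] by metis
    then have "cav (c *\<^sub>R x) = cav x"
      using outer_map_scale[of x c] near x by (intro eq) auto
    then show ?thesis
      using c by (metis add_0 diff_zero image_eqI)
  qed
qed

section \<open>The (INV) condition for small cubes\<close>

lemma AE_finite_compl: "finite S \<Longrightarrow> AE x in lebesgue. x \<notin> S" for S :: "'a::euclidean_space set"
  by (intro AE_not_in) (simp add: null_sets_completionI finite_imp_null_set_lborel)

lemma finite_sing: "finite sing"
  by (simp add: sing_def)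

text \<open>The line through one of the four sides separates a point outside the open square weakly
  from the closed square, which contains the image of the frontier. So the half-plane criterion
  applies.\<close>

lemma im_T_cav:
  assumes r: "0 < r" and R: "\<And>x. x \<in> cube a r \<Longrightarrow> infnorm x \<le> 2" "frontier (cube a r) \<inter> sing = {}"
    and y: "y \<in> im_T cav (cube a r)"
  shows "infnorm y < 2"
proof (rule ccontr)
  assume "\<not> infnorm y < 2"
  then consider "2 \<le> fst y" | "fst y \<le> -2" | "2 \<le> snd y" | "snd y \<le> -2"
    by (auto simp: infnorm_pair le_max_iff_disj not_less abs_if split: if_splits)
  then obtain n where n: "n \<noteq> 0" "\<And>w. infnorm w \<le> 2 \<Longrightarrow> n \<bullet> (w - y) \<le> 0"
  proof cases
    case 1
    then show ?thesis by (intro that[of "(1, 0)"]) (auto simp: infnorm_pair zero_prod_def inner_prod_def abs_le_iff)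
  next
    case 2
    then show ?thesis by (intro that[of "(-1, 0)"]) (auto simp: infnorm_pair zero_prod_def inner_prod_def abs_le_iff)
  next
    case 3
    then show ?thesis by (intro that[of "(0, 1)"]) (auto simp: infnorm_pair zero_prod_def inner_prod_def abs_le_iff)
  next
    case 4
    then show ?thesis by (intro that[of "(0, -1)"]) (auto simp: infnorm_pair zero_prod_def inner_prod_def abs_le_iff)
  qed
  have sub: "frontier (cube a r) \<subseteq> cube a r"
    by (rule frontier_subset_closed[OF closed_cube])
  have cont: "continuous_on (frontier (cube a r)) cav"
    using R(2) by (intro continuous_on_subset[OF continuous_on_cav]) auto
  have half: "n \<bullet> (cav x - y) \<le> 0" if "x \<in> frontier (cube a r)" for x
    using that sub by (intro n(2) infnorm_cav_le R(1)) auto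
  have "brouwer_deg cav (cube a r) y = 0"
    by (rule brouwer_deg_half_plane[OF r cont n(1) half]) (use y in \<open>auto simp: im_T_def\<close>)
  with y show False
    by (simp add: im_T_def)
qed

lemma INV_cav:
  assumes r: "0 < r" and R: "\<And>x. x \<in> cube a r \<Longrightarrow> infnorm x < 2" "frontier (cube a r) \<inter> sing = {}"
    and img: "\<And>x. x \<in> cube a r - sing \<Longrightarrow> cav x \<in> cav ` frontier (cube a r)"
  shows "INV ({-2<..<2} \<times> {-2<..<2}) cav (cube a r)"
  unfolding INV_def
proof (intro conjI)
  show "compact (closure (cube a r))"
    by (simp add: cube_eq_cbox)
  show "closure (cube a r) \<subseteq> {-2<..<2} \<times> {-2<..<2}"
    using R(1) by (auto simp only: square_infnorm closure_closed[OF closed_cube])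
  show "continuous_on (frontier (cube a r)) cav"
    using R(2) by (intro continuous_on_subset[OF continuous_on_cav]) auto
  show "AE x in lebesgue. x \<in> cube a r \<longrightarrow> cav x \<in> im_T cav (cube a r) \<union> cav ` frontier (cube a r)"
    using AE_finite_compl[OF finite_sing] by eventually_elim (use img in auto)
  have out: "cav x \<notin> im_T cav (cube a r)" if "x \<in> {-2<..<2} \<times> {-2<..<2}" "x \<notin> sing" for x
  proof
    assume "cav x \<in> im_T cav (cube a r)"
    then have "infnorm (cav x) < 2"
      using less_imp_le[OF R(1)] R(2) by (intro im_T_cav[OF r])
    moreover have "infnorm x \<le> 2"
      using that(1) by (simp only: square_infnorm mem_Collect_eq less_imp_le)
    ultimately show False
      using infnorm_cav[OF _ that(2)] by simp
  qed
  show "AE x in lebesgue. x \<in> {-2<..<2} \<times> {-2<..<2} - cube a r \<longrightarrow> cav x \<notin> im_T cav (cube a r)"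
    using AE_finite_compl[OF finite_sing] by (rule eventually_mono) (use out in blast)
qed

lemma cav_ray_inner:
  assumes "p = ptA \<and> snd x \<le> 9/8 \<or> p = ptB \<and> 9/8 \<le> snd x" "0 < c" "c \<le> 1"
    and "z = p + c *\<^sub>R (x - p)"
    and "\<bar>fst x\<bar> \<le> lens x" "0 < lens x" "\<bar>fst z\<bar> \<le> lens z" "0 < lens z"
  shows "cav z = cav x"
proof -
  have "inner_map z = c *\<^sub>R inner_map x"
    using assms(1-4) inner_map_scale_A[of x c] inner_map_scale_B[of x c] by auto
  then show ?thesis
    using assms(2,5-8) dipole_bound[of x] dipole_bound[of z] by (simp add: cav_inner rho_scale)
qed

text \<open>Up to distance 1/8 the neighbourhoods of \<open>ptA\<close> and \<open>ptB\<close> stay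
  in the lens and on their own sides of height 9/8, while that of the origin stays below the dipole.
  So a single homogeneous formula is valid around each pole.\<close>

lemma cav_const_ray:
  assumes "s \<in> sing" and "infnorm (x - s) \<le> 1/8" and "0 < c" and "infnorm (c *\<^sub>R (x - s)) \<le> 1/8"
  shows "cav (s + c *\<^sub>R (x - s)) = cav x"
proof -
  have *: "cav z = cav x" if s: "s \<in> sing" and x: "infnorm (x - s) \<le> 1/8" and c: "0 < c" "c \<le> 1"
    and z: "z = s + c *\<^sub>R (x - s)" "infnorm (z - s) \<le> 1/8" for x z c
  proof (cases "s = 0")
    case True
    have "snd v + infnorm v \<le> 2 \<and> v \<in> outer_dom \<and> infnorm (outer_map v) \<le> 2" if "infnorm (v - s) \<le> 1/8" for v
    proof -
      have v: "infnorm v \<le> 1/8" "\<bar>snd v\<bar> \<le> 1/8"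
        using that True by (simp_all add: infnorm_pair)
      then have "snd (dipole v) < 0"
        by (simp add: dipole_def)
      then have "v \<in> outer_dom"
        unfolding outer_dom_def by (simp add: order.strict_trans2[OF _ abs_ge_zero])
      moreover have "infnorm (outer_map v) \<le> 2"
        using v by (intro outer_bound) simp
      ultimately show ?thesis
        using v by simp
    qed
    from this[OF x] this[OF z(2)] show ?thesis
      using outer_map_scale[of x c] c z(1) True by (simp add: cav_outer_dom rho_scale)
  next
    case False
    have lens: "\<bar>fst v\<bar> \<le> lens v \<and> 0 < lens v \<and> (s = ptA \<longrightarrow> snd v \<le> 9/8) \<and> (s = ptB \<longrightarrow> 9/8 \<le> snd v)"
      if v: "infnorm (v - s) \<le> 1/8" for v
    proof -
      have "\<bar>fst v + 1/4\<bar> \<le> 1/8" "\<bar>snd v - 3/4\<bar> \<le> 1/8 \<and> s = ptA \<or> \<bar>snd v - 3/2\<bar> \<le> 1/8 \<and> s = ptB"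
        using v s False unfolding infnorm_pair max.bounded_iff sing_def ptA_def ptB_def by auto
      then have "\<bar>fst v\<bar> \<le> 3/8" "5/8 \<le> snd v" "snd v \<le> 13/8" "snd v \<le> 9/8 \<and> s = ptA \<or> 9/8 \<le> snd v \<and> s = ptB"
        by linarith+
      moreover from this have "infnorm v \<le> 13/8" "0 < lens v"
        by (simp_all add: infnorm_pair lens_pos_iff)
      moreover have "ptA \<noteq> ptB"
        by (simp add: ptA_def ptB_def)
      ultimately show ?thesis
        by (auto simp: le_lens_iff)
    qed
    then show ?thesis
      using lens[OF x] lens[OF z(2)] s False c by (intro cav_ray_inner[OF _ _ _ z(1)]) (auto simp: sing_def)
  qed
  let ?z = "s + c *\<^sub>R (x - s)"
  show ?thesis
  proof (cases "c \<le> 1")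
    case True
    then show ?thesis
      using assms by (intro *[of x c]) auto
  next
    case False
    \<comment> \<open>For \<open>c > 1\<close> the roles of \<open>x\<close> and \<open>?z\<close>
      are exchanged.\<close>
    then have "cav x = cav ?z"
      using assms by (intro *[of ?z "1 / c"]) auto
    then show ?thesis
      by simp
  qed
qed

lemma INV_cubes_cav: "INV_cubes ({-2<..<2} \<times> {-2<..<2}) cav"
  unfolding INV_cubes_def
proof
  fix a :: "real \<times> real"
  assume "a \<in> {-2<..<2} \<times> {-2<..<2}"
  then have a: "infnorm a < 2"
    unfolding square_infnorm by simp
  have "open {x :: real \<times> real. infnorm x < 2}"
    by (intro open_Collect_less continuous_intros)
  then obtain d\<^sub>1 where d1: "0 < d\<^sub>1" "\<And>r x. r < d\<^sub>1 \<Longrightarrow> x \<in> cube a r \<Longrightarrow> infnorm x < 2"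
    using eventually_cube_subset[of "{x. infnorm x < 2}" a] a by auto
  \<comment> \<open>The centre may itself be a pole; it is never on the frontier, as
    \<open>0 < r\<close>.\<close>
  have "open (- (sing - {a}))"
    using finite_sing by (intro open_Compl finite_imp_closed) auto
  then obtain d\<^sub>2 where d2: "0 < d\<^sub>2" "\<And>r x. r < d\<^sub>2 \<Longrightarrow> x \<in> cube a r \<Longrightarrow> x \<notin> sing - {a}"
    using eventually_cube_subset[of "- (sing - {a})" a] by (metis Compl_iff Diff_iff singletonI)
  have fr: "frontier (cube a r) \<inter> sing = {}" if "0 < r" "r < d\<^sub>2" for r
  proof -
    have "x \<notin> sing" if x: "x \<in> frontier (cube a r)" for x
    proof
      assume "x \<in> sing"
      moreover have "x \<in> cube a r"
        using x frontier_subset_closed[OF closed_cube, of a r] by auto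
      ultimately have "x = a"
        using d2(2)[OF \<open>r < d\<^sub>2\<close>] by auto
      with x \<open>0 < r\<close> show False
        by (simp add: frontier_cube infnorm_0)
    qed
    then show ?thesis
      by auto
  qed
  have "\<exists>d>0. \<forall>r. 0 < r \<and> r < d \<and> r < d\<^sub>1 \<and> r < d\<^sub>2 \<longrightarrow> (\<forall>x \<in> cube a r - sing. cav x \<in> cav ` frontier (cube a r))"
  proof (cases "a \<in> sing")
    case True
    have "cav x \<in> cav ` frontier (cube a r)" if r: "0 < r" "r < 1/8" and x: "x \<in> cube a r - sing" for r x
    proof -
      have xa: "0 < infnorm (x - a)" "infnorm (x - a) \<le> r"
        using x True infnorm_pos_lt[of "x - a"] by (auto simp: cube_infnorm)
      let ?c = "r / infnorm (x - a)"
      have "infnorm (?c *\<^sub>R (x - a)) = r"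
        using xa r by (simp add: infnorm_mul)
      then have "cav (a + ?c *\<^sub>R (x - a)) = cav x" "a + ?c *\<^sub>R (x - a) \<in> frontier (cube a r)"
        using xa r True by (auto intro!: cav_const_ray simp: frontier_cube)
      then show ?thesis
        by (metis image_eqI)
    qed
    then show ?thesis
      by (intro exI[of _ "1/8"]) auto
  next
    case a_sing: False
    show ?thesis
    proof (cases "a \<in> inner_dom")
      case True
      then obtain d where d: "0 < d" "\<And>r x. r < d \<Longrightarrow> x \<in> cube a r \<Longrightarrow> x \<in> inner_dom"
        using eventually_cube_subset[OF open_inner_dom] by metis
      have "cav x \<in> cav ` frontier (cube a r)"
        if "r < d" "r < d\<^sub>2" "x \<in> cube a r" for r x
        using that d2(2) d(2) a_sing by (intro cav_frontier_inner closed_cube) auto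
      with d(1) show ?thesis
        by auto
    next
      case False
      then have "a \<in> outer_dom"
        using dom_cover by blast
      then obtain d where d: "0 < d" "\<And>r x. r < d \<Longrightarrow> x \<in> cube a r \<Longrightarrow> x \<in> outer_dom"
        using eventually_cube_subset[OF open_outer_dom] by metis
      have "open {x :: real \<times> real. snd x \<noteq> 0}" "open {x :: real \<times> real. snd x + infnorm x < 2}"
        by (intro open_Collect_less open_Collect_neq continuous_intros)+
      then have "\<exists>e>0. \<forall>r<e. (\<forall>x\<in>cube a r. snd x \<noteq> 0) \<or> (\<forall>x\<in>cube a r. snd x + infnorm x \<le> 2)"
      proof (cases "snd a = 0")
        case True
        \<comment> \<open>Here \<open>infnorm a < 2\<close> is the whole condition, since
          \<open>snd a = 0\<close>.\<close>
        then have "a \<in> {x. snd x + infnorm x < 2}"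
          using a by simp
        from eventually_cube_subset[OF \<open>open {x :: real \<times> real. snd x + infnorm x < 2}\<close> this] obtain e where "0 < e"
          "\<And>r x. r < e \<Longrightarrow> x \<in> cube a r \<Longrightarrow> x \<in> {x. snd x + infnorm x < 2}"
          by blast
        then show ?thesis
          by (intro exI[of _ e]) (auto intro: less_imp_le)
      next
        case False
        then have "a \<in> {x. snd x \<noteq> 0}"
          by simp
        from eventually_cube_subset[OF \<open>open {x :: real \<times> real. snd x \<noteq> 0}\<close> this] obtain e where "0 < e"
          "\<And>r x. r < e \<Longrightarrow> x \<in> cube a r \<Longrightarrow> x \<in> {x. snd x \<noteq> 0}"
          by blast
        then show ?thesis
          by (intro exI[of _ e]) auto
      qed
      then obtain e where e: "0 < e" "\<And>r. r < e \<Longrightarrow> (\<forall>x\<in>cube a r. snd x \<noteq> 0) \<or> (\<forall>x\<in>cube a r. snd x + infnorm x \<le> 2)"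
        by blast
      have "cav x \<in> cav ` frontier (cube a r)"
        if r: "0 < r" "r < d" "r < d\<^sub>1" "r < d\<^sub>2" "r < e" and x: "x \<in> cube a r" for r x
      proof (rule cav_frontier_outer[OF r(1)])
        show "0 \<notin> cube a r"
          using d2(2)[OF r(4), of 0] a_sing by (auto simp: sing_def)
        show "infnorm x \<le> 2" if "x \<in> cube a r" for x
          using d1(2)[OF r(3) that] by simp
      qed (use e(2)[OF r(5)] d(2)[OF r(2)] x in auto)
      then show ?thesis
        using d(1) e(1) by (intro exI[of _ "min d e"]) auto
    qed
  qed
  then obtain d\<^sub>3 where d3: "0 < d\<^sub>3"
    "\<And>r x. 0 < r \<Longrightarrow> r < d\<^sub>3 \<Longrightarrow> r < d\<^sub>1 \<Longrightarrow> r < d\<^sub>2 \<Longrightarrow> x \<in> cube a r - sing \<Longrightarrow> cav x \<in> cav ` frontier (cube a r)"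
    by blast
  show "\<exists>r\<^sub>a>0. AE r in lebesgue. 0 < r \<and> r < r\<^sub>a \<longrightarrow> INV ({-2<..<2} \<times> {-2<..<2}) cav (cube a r)"
  proof (intro exI conjI AE_I2 impI)
    show "0 < min d\<^sub>1 (min d\<^sub>2 d\<^sub>3)"
      using d1 d2 d3 by simp
    show "INV ({-2<..<2} \<times> {-2<..<2}) cav (cube a r)" if "0 < r \<and> r < min d\<^sub>1 (min d\<^sub>2 d\<^sub>3)" for r
      using that d1(2)[of r] d3(2)[of r] by (intro INV_cav fr) auto
  qed
qed

section \<open>Degrees on the two cubes\<close>

text \<open>For the first coordinate of a straight line homotopy between maps whose first
  coordinates never have opposite signs: a zero forces the end value \<open>q\<close> to
  vanish.\<close>

lemma eq_0_of_same_sign: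
  fixes p q a s :: real
  assumes "a * p + s * q = 0" "0 \<le> a" "0 < s" "0 \<le> q \<Longrightarrow> 0 \<le> p" "q \<le> 0 \<Longrightarrow> p \<le> 0"
  shows "q = 0"
  using assms by (metis add_nonneg_eq_0_iff add_nonpos_eq_0_iff mult_eq_0_iff less_le linorder_linear mult_nonneg_nonneg mult_nonneg_nonpos)

definition large_cube :: "real \<Rightarrow> (real \<times> real) set" where "large_cube t = cube 0 (1 + t)"
definition pole_cube :: "real \<Rightarrow> (real \<times> real) set" where "pole_cube t = cube ptA (1/4 - t)"

lemma pole_cube_lens:
  assumes t: "0 \<le> t" "t < 1/8" and x: "x \<in> pole_cube t"
  shows "\<bar>fst x\<bar> \<le> lens x" "0 < lens x" "snd x \<le> 1 - t" "infnorm x < 2"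
proof -
  have *: "\<bar>fst x + 1/4\<bar> \<le> 1/4 - t" "\<bar>snd x - 3/4\<bar> \<le> 1/4 - t"
    using x by (simp_all add: pole_cube_def cube_infnorm infnorm_pair ptA_def)
  then have **: "\<bar>fst x\<bar> \<le> 1/2" "1/2 \<le> snd x" "snd x \<le> 1 - t" "snd x \<le> 1"
    using t by linarith+
  then have "infnorm x \<le> 1"
    by (simp add: infnorm_pair)
  with ** show "\<bar>fst x\<bar> \<le> lens x" "0 < lens x" "snd x \<le> 1 - t" "infnorm x < 2"
    by (simp_all add: lens_pos_iff le_lens_iff)
qed

lemma frontier_avoids_sing:
  assumes t: "0 \<le> t" "t < 1/8"
  shows "frontier (large_cube t) \<inter> sing = {}" "frontier (pole_cube t) \<inter> sing = {}"
proof -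
  have "infnorm ptA = 3/4" "infnorm ptB = 3/2" "infnorm (ptB - ptA) = 3/4"
    by (simp_all add: infnorm_pair ptA_def ptB_def)
  then show "frontier (large_cube t) \<inter> sing = {}" "frontier (pole_cube t) \<inter> sing = {}"
    using t by (auto simp: large_cube_def pole_cube_def frontier_cube sing_def infnorm_0 infnorm_neg)
qed

lemma continuous_frontier:
  assumes t: "0 \<le> t" "t < 1/8"
  shows "continuous_on (frontier (large_cube t)) cav" "continuous_on (frontier (pole_cube t)) cav"
  using frontier_avoids_sing[OF t] by (auto intro!: continuous_on_subset[OF continuous_on_cav])

lemma pole_cube_subset: "0 \<le> t \<Longrightarrow> t < 1/8 \<Longrightarrow> pole_cube t \<subseteq> large_cube t"
  unfolding large_cube_def pole_cube_def cube_infnorm ptA_def infnorm_pair by (auto simp: abs_le_iff)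

text \<open>Points of the rhombus are pushed along the ray from \<open>ptA\<close> up to the top
  side of the large cube. All other points have the value \<open>(0, 2)\<close>, which is also taken
  on that side.\<close>

lemma cav_pole_cube_subset:
  assumes t: "0 \<le> t" "t < 1/8"
  shows "cav ` (pole_cube t - sing) \<subseteq> cav ` frontier (large_cube t)"
proof (intro image_subsetI)
  fix x assume "x \<in> pole_cube t - sing"
  then have x: "x \<in> pole_cube t" "x \<notin> sing"
    by auto
  note xl = pole_cube_lens[OF t x(1)]
  have dip: "dipole x = x - ptA"
    using xl t by (intro dipole_A) simp
  show "cav x \<in> cav ` frontier (large_cube t)"
  proof (cases "\<bar>fst (dipole x)\<bar> \<le> snd (dipole x)")
    case True
    then have pos: "0 < snd (x - ptA)"
      using x(2) by (auto simp: dip sing_def prod_eq_iff)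
    \<comment> \<open>The height of the top side above \<open>ptA\<close> is
      \<open>1 + t - 3/4\<close>.\<close>
    let ?k = "(1/4 + t) / snd (x - ptA)"
    define z where "z = ptA + ?k *\<^sub>R (x - ptA)"
    have snd_z: "snd z = 1 + t"
      using pos by (simp add: z_def ptA_def)
    have k: "1 \<le> ?k" "?k > 0"
      using pos xl t by (simp_all add: ptA_def)
    have "\<bar>fst (z - ptA)\<bar> \<le> 1/4 + t"
    proof -
      have "fst (z - ptA) = ?k * fst (x - ptA)"
        by (simp add: z_def)
      then have "\<bar>fst (z - ptA)\<bar> = ?k * \<bar>fst (x - ptA)\<bar>"
        using k(2) by (simp only: abs_mult abs_of_pos)
      also have "\<dots> \<le> ?k * snd (x - ptA)"
        using True k(2) by (intro mult_left_mono) (auto simp: dip)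
      finally show ?thesis
        using pos by simp
    qed
    then have fst_z: "\<bar>fst z\<bar> \<le> 5/8"
      using t by (simp add: ptA_def)
    have zQ: "z \<in> frontier (large_cube t)"
      using fst_z t snd_z by (simp add: large_cube_def frontier_cube infnorm_pair)
    have "infnorm z = 1 + t"
      using fst_z t snd_z by (simp add: infnorm_pair)
    then have "lens z = 1 - t"
      using t snd_z by (simp add: lens_def)
    then have zl: "0 < lens z" "\<bar>fst z\<bar> \<le> lens z"
      using fst_z t by simp_all
    have "x = ptA + (1 / ?k) *\<^sub>R (z - ptA)"
      using pos t by (auto simp: z_def)
    moreover have "0 < 1 / ?k" "1 / ?k \<le> 1"
      using k by (simp_all only: zero_less_divide_1_iff divide_le_eq_1_pos)
    moreover have "snd z \<le> 9/8"
      using snd_z t by simp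
    ultimately have "cav x = cav z"
      using cav_ray_inner[of ptA z "1 / ?k" x] xl(1,2) zl by blast
    with zQ show ?thesis
      by blast
  next
    case False
    then have "rho (inner_map x) = (0, 2)"
      by (intro inner_map_outside xl) simp
    then have "cav x = (0, 2)"
      using xl by (simp add: cav_inner)
    \<comment> \<open>A point of the top side in the lens but outside the rhombus.\<close>
    moreover have z: "0 < lens (1/2, 1 + t)" "\<bar>fst (1/2, 1 + t)\<bar> \<le> lens (1/2, 1 + t)"
      using t by (simp_all add: lens_pos_iff le_lens_iff infnorm_pair)  (simp_all add: lens_def infnorm_pair)
    then have "cav (1/2, 1 + t) = (0, 2)"
      using t by (subst cav_inner, simp, simp, intro inner_map_outside) (auto simp: dipole_def)
    moreover have "(1/2, 1 + t) \<in> frontier (large_cube t)"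
      using t by (simp add: large_cube_def frontier_cube infnorm_pair)
    ultimately show ?thesis
      by (metis image_eqI)
  qed
qed

lemma rho_multiple: "w \<noteq> 0 \<Longrightarrow> \<exists>k>0. rho w = k *\<^sub>R w"
  using infnorm_pos_lt[of w] unfolding rho_def by (intro exI[of _ "2 / min 2 (infnorm w)"]) simp

lemma inner_map_fst_sign:
  "0 \<le> fst x + 1/4 \<Longrightarrow> 0 \<le> fst (inner_map x)"
  "fst x + 1/4 \<le> 0 \<Longrightarrow> fst (inner_map x) \<le> 0"
  unfolding inner_map_def dipole_def fold_map_def by simp_all

lemma inner_map_axis: "fst x + 1/4 = 0 \<Longrightarrow> snd (inner_map x) = - snd (dipole x) / 2"
  by (simp add: inner_map_def dipole_def fold_map_def diff_divide_distrib)

text \<open>The straight line homotopy to \<open>(x + 1/4, - \<bar>y\<bar>)\<close>, whose values are in a half-plane, avoids 0.\<close>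

lemma deg_large_cube:
  assumes t: "0 \<le> t" "t < 1/8"
  shows "brouwer_deg cav (large_cube t) 0 = 0"
proof -
  let ?g = "\<lambda>x :: real \<times> real. (fst x + 1/4, - \<bar>snd x\<bar>)"
  have r: "0 < 1 + t"
    using t by simp
  have contg: "continuous_on (frontier (cube 0 (1 + t))) ?g"
    by (intro continuous_intros)
  have no: "(1 - s) *\<^sub>R (cav x - 0) + s *\<^sub>R (?g x - 0) \<noteq> 0" if s: "s \<in> {0..1}" and x: "x \<in> frontier (large_cube t)" for s x
  proof
    assume "(1 - s) *\<^sub>R (cav x - 0) + s *\<^sub>R (?g x - 0) = 0"
    moreover define w where "w = (if \<bar>fst x\<bar> < lens x then inner_map x else outer_map x)"
    moreover have x_sing: "x \<notin> sing"
      using x frontier_avoids_sing(1)[OF t] by auto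
    then have "w \<noteq> 0"
      using inner_map_eq_0[of x] outer_map_eq_0[of x] by (auto simp: w_def sing_def)
    moreover from this obtain k where k: "0 < k" "cav x = k *\<^sub>R w"
      using rho_multiple[of w] by (auto simp: cav_def w_def)
    ultimately have e: "((1 - s) * k) * fst w + s * (fst x + 1/4) = 0" "((1 - s) * k) * snd w = s * \<bar>snd x\<bar>"
      by (simp_all add: prod_eq_iff mult.assoc)
    have a: "0 \<le> (1 - s) * k"
      using s k by simp
    have s0: "0 < s"
    proof (rule ccontr)
      assume "\<not> 0 < s"
      with s have "s = 0"
        by simp
      with e k \<open>w \<noteq> 0\<close> show False
        by (simp add: prod_eq_iff)
    qed
    have Qx: "max \<bar>fst x\<bar> \<bar>snd x\<bar> = 1 + t"
      using x by (simp add: large_cube_def frontier_cube infnorm_pair)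
    have near: "\<bar>snd x\<bar> = 1 + t" if "-1/4 \<le> fst x" "fst x \<le> 0"
      using Qx that t by (auto simp: max_def split: if_splits)
    have lens1: "lens x = 1 - t" if "snd x = 1 + t"
    proof -
      have "infnorm x = 1 + t"
        using Qx by (simp add: infnorm_pair)
      then show ?thesis
        using that t by (simp add: lens_def)
    qed
    show False
    proof (cases "\<bar>fst x\<bar> < lens x")
      case True
      then have w: "w = inner_map x" "0 < snd x"
        using lens_pos[of x] by (auto simp: w_def)
      \<comment> \<open>The numbers \<open>fst (inner_map x)\<close> and \<open>fst x + 1/4\<close>
        never have opposite signs, so \<open>x\<close> is on the vertical line through
        \<open>ptA\<close> and \<open>ptB\<close>. There, on the top side, \<open>inner_map\<close>
        points downwards, whereas the second equation requires it to point upwards.\<close>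
      have "fst x + 1/4 = 0"
        by (rule eq_0_of_same_sign[OF e(1) a s0]) (use inner_map_fst_sign[of x] w in auto)
      moreover from this near w have "snd x = 1 + t"
        by simp
      ultimately have "snd w < 0"
        using t by (simp add: w inner_map_axis dipole_def)
      then have "((1 - s) * k) * snd w \<le> 0"
        using a by (intro mult_nonneg_nonpos) auto
      then show False
        using e(2) s0 w(2) by (simp add: mult_le_0_iff)
    next
      case False
      then have w: "w = outer_map x"
        by (simp add: w_def)
      \<comment> \<open>The sign of \<open>fst (outer_map x)\<close> follows \<open>fst x\<close>
        instead of \<open>fst x + 1/4\<close>, so the sign argument leaves a strip. In the strip the
        bottom side is excluded by the second equation, and the top side lies in the lens.\<close>
      have "-1/4 \<le> fst x \<and> fst x \<le> 0"
      proof (rule ccontr)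
        assume "\<not> ?thesis"
        then have "fst x + 1/4 = 0"
          using fst_outer_map_nonneg[of x] fst_outer_map_nonpos[of x]
          by (intro eq_0_of_same_sign[OF e(1) a s0]) (auto simp: w)
        with \<open>\<not> ?thesis\<close> show False
          by simp
      qed
      moreover from this have y: "\<bar>snd x\<bar> = 1 + t"
        by (intro near) auto
      moreover have "0 < snd x"
      proof (rule ccontr)
        assume "\<not> 0 < snd x"
        then have "((1 - s) * k) * snd w \<le> 0"
          using a by (intro mult_nonneg_nonpos) (auto simp: w)
        then show False
          using e(2) s0 y t by (simp add: mult_le_0_iff)
      qed
      ultimately show False
        using False lens1 t by simp
    qed
  qed
  have "brouwer_deg cav (large_cube t) 0 = brouwer_deg ?g (large_cube t) 0"
    unfolding large_cube_def
    by (rule brouwer_deg_straight_line[OF r continuous_frontier(1)[OF t, unfolded large_cube_def] contg])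
      (use no in \<open>simp add: large_cube_def\<close>)
  also have "\<dots> = 0"
    unfolding large_cube_def
  proof (rule brouwer_deg_half_plane[OF r contg])
    show "(0, 1) \<noteq> (0 :: real \<times> real)"
      by (simp add: zero_prod_def)
    show "(0, 1) \<bullet> (?g x - 0) \<le> 0" for x
      by (simp add: inner_prod_def)
    have "?g x \<noteq> 0" if "infnorm x = 1 + t" for x
      using that t by (auto simp: infnorm_pair zero_prod_def max_def abs_if split: if_splits)
    then show "0 \<notin> ?g ` frontier (cube 0 (1 + t))"
      by (auto simp: frontier_cube)
  qed
  finally show ?thesis .
qed

text \<open>The target is first moved to 0, which is possible because \<open>cav\<close> has maximum
  norm 2 on the frontier. Then \<open>cav\<close> is deformed to the reflection in the horizontal
  line through \<open>ptA\<close>: the first coordinates never have opposite signs, and where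
  \<open>fst x = -1/4\<close> both second coordinates are nonnegative multiples of
  \<open>3/4 - snd x\<close>.\<close>

lemma deg_pole_cube:
  assumes t: "0 \<le> t" "t < 1/8" and y: "infnorm y < 2"
  shows "brouwer_deg cav (pole_cube t) y = -1"
proof -
  let ?g = "\<lambda>x. (fst (x - ptA), - snd (x - ptA))"
  have r: "0 < 1/4 - t"
    using t by simp
  have contg: "continuous_on (frontier (pole_cube t)) ?g"
    by (intro continuous_intros)
  have fr: "infnorm (cav x) = 2" "x \<in> pole_cube t" if "x \<in> frontier (pole_cube t)" for x
  proof -
    show "x \<in> pole_cube t"
      using that frontier_subset_closed[OF closed_cube, of ptA] unfolding pole_cube_def by blast
    then show "infnorm (cav x) = 2"
      using that frontier_avoids_sing[OF t] pole_cube_lens[OF t] by (intro infnorm_cav) (auto simp: less_imp_le)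
  qed
  have "(1 - s) *\<^sub>R (cav x - y) + s *\<^sub>R (cav x - 0) \<noteq> 0" if s: "s \<in> {0..1}" and x: "x \<in> frontier (pole_cube t)" for s x
  proof
    assume "(1 - s) *\<^sub>R (cav x - y) + s *\<^sub>R (cav x - 0) = 0"
    then have "cav x = (1 - s) *\<^sub>R y"
      by (simp add: algebra_simps)
    then have "infnorm (cav x) = (1 - s) * infnorm y"
      using s by (simp add: infnorm_mul)
    also have "\<dots> \<le> 1 * infnorm y"
      using s infnorm_pos_le[of y] by (intro mult_right_mono) auto
    finally show False
      using fr(1)[OF x] y by simp
  qed
  then have "brouwer_deg cav (pole_cube t) y = brouwer_deg cav (pole_cube t) 0"
    unfolding pole_cube_def using continuous_frontier(2)[OF t] by (intro brouwer_deg_straight_line r) (auto simp: pole_cube_def)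
  also have "\<dots> = brouwer_deg ?g (pole_cube t) 0"
  proof -
    have "(1 - s) *\<^sub>R (cav x - 0) + s *\<^sub>R (?g x - 0) \<noteq> 0" if s: "s \<in> {0..1}" and x: "x \<in> frontier (pole_cube t)" for s x
    proof
      assume "(1 - s) *\<^sub>R (cav x - 0) + s *\<^sub>R (?g x - 0) = 0"
      moreover have x_sing: "x \<notin> sing"
        using x frontier_avoids_sing(2)[OF t] by auto
      then have w: "inner_map x \<noteq> 0"
        using inner_map_eq_0[of x] by (auto simp: sing_def)
      moreover have xl: "\<bar>fst x\<bar> \<le> lens x" "0 < lens x" "snd x \<le> 1 - t"
        using pole_cube_lens[OF t fr(2)[OF x]] by auto
      moreover obtain k where k: "0 < k" "cav x = k *\<^sub>R inner_map x"
        using rho_multiple[OF w] cav_inner[OF xl(1,2)] by auto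
      ultimately have e: "((1 - s) * k) * fst (inner_map x) + s * (fst x + 1/4) = 0"
          "((1 - s) * k) * snd (inner_map x) + s * (3/4 - snd x) = 0"
        by (simp_all add: prod_eq_iff mult.assoc ptA_def)
      have a: "0 \<le> (1 - s) * k"
        using s k by simp
      have s0: "0 < s"
      proof (rule ccontr)
        assume "\<not> 0 < s"
        with s have "s = 0"
          by simp
        with e k w show False
          by (simp add: prod_eq_iff)
      qed
      have u: "fst x + 1/4 = 0"
        by (rule eq_0_of_same_sign[OF e(1) a s0]) (use inner_map_fst_sign[of x] in auto)
      define y where "y = snd x - 3/4"
      have "snd (inner_map x) = - y / 2" "3/4 - snd x = - y"
        using u xl t by (simp_all add: inner_map_axis dipole_A ptA_def y_def)
      then have "((1 - s) * k) * (- y / 2) + s * (- y) = 0"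
        using e(2) by simp
      then have "((1 - s) * k / 2 + s) * y = 0"
        by (simp add: algebra_simps)
      then have "y = 0"
        using a s0 by simp
      with u have "x = ptA"
        by (simp add: ptA_def prod_eq_iff y_def)
      with x_sing show False
        by (simp add: sing_def)
    qed
    then show ?thesis
      unfolding pole_cube_def using continuous_frontier(2)[OF t] contg by (intro brouwer_deg_straight_line r) (auto simp: pole_cube_def)
  qed
  also have "\<dots> = -1"
    unfolding pole_cube_def by (rule brouwer_deg_reflection_snd[OF r])
  finally show ?thesis .
qed

section \<open>Sobolev regularity\<close>

text \<open>The coordinates of \<open>rho (K z)\<close> are quotients of piecewise affine functions
  with denominator \<open>l\<close>, the minimum of 2 and the maximum norm. Where this norm is at
  most 2, the quotients are bounded by 2, which gives the factor 3.\<close>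

lemma rho_derivative:
  fixes K :: "real \<times> real \<Rightarrow> real \<times> real"
  assumes "piecewise_affine (\<lambda>x. fst (K x))" "piecewise_affine (\<lambda>x. snd (K x))"
  shows "\<exists>L M. hyperplanes L \<and> 0 \<le> M \<and>
    (\<forall>x\<in>off L. K x \<noteq> 0 \<longrightarrow> infnorm (K x) \<le> 2 \<longrightarrow>
      (\<exists>D. ((\<lambda>z. rho (K z)) has_derivative D) (at x) \<and> (\<forall>b. norm (D b) \<le> M * norm b / infnorm (K x))))"
proof -
  define l where "l x = min 2 (max \<bar>fst (K x)\<bar> \<bar>snd (K x)\<bar>)" for x
  have l: "piecewise_affine l"
    unfolding l_def by (intro piecewise_affine_intros assms)
  have k: "piecewise_affine (\<lambda>x. 2 * fst (K x))" "piecewise_affine (\<lambda>x. 2 * snd (K x))"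
    by (intro piecewise_affine_intros assms)+
  obtain L1 M1 where 1: "hyperplanes L1" "0 \<le> M1"
    "\<forall>x\<in>off L1. l x \<noteq> 0 \<longrightarrow> (\<exists>D. ((\<lambda>z. 2 * fst (K z) / l z) has_derivative D) (at x) \<and>
       (\<forall>b. \<bar>D b\<bar> \<le> M1 * norm b * (1 + \<bar>2 * fst (K x) / l x\<bar>) / \<bar>l x\<bar>))"
    using quotient_derivative[OF k(1) l] by (elim exE conjE) (rule that)
  obtain L2 M2 where 2: "hyperplanes L2" "0 \<le> M2"
    "\<forall>x\<in>off L2. l x \<noteq> 0 \<longrightarrow> (\<exists>D. ((\<lambda>z. 2 * snd (K z) / l z) has_derivative D) (at x) \<and>
       (\<forall>b. \<bar>D b\<bar> \<le> M2 * norm b * (1 + \<bar>2 * snd (K x) / l x\<bar>) / \<bar>l x\<bar>))"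
    using quotient_derivative[OF k(2) l] by (elim exE conjE) (rule that)
  have "\<exists>D. ((\<lambda>z. rho (K z)) has_derivative D) (at x) \<and> (\<forall>b. norm (D b) \<le> (3 * (M1 + M2)) * norm b / infnorm (K x))"
    if x: "x \<in> off (L1 \<union> L2)" "K x \<noteq> 0" "infnorm (K x) \<le> 2" for x
  proof -
    have xL: "x \<in> off L1" "x \<in> off L2"
      using x(1) unfolding off_Un by blast+
    have lx: "l x = infnorm (K x)" "0 < l x" "l x \<noteq> 0"
      using x infnorm_pos_lt[of "K x"] by (simp_all add: l_def infnorm_pair[symmetric])
    have ratio: "\<bar>2 * fst (K x) / l x\<bar> \<le> 2" "\<bar>2 * snd (K x) / l x\<bar> \<le> 2"
      using lx(2) unfolding lx(1) by (simp_all add: abs_mult divide_le_eq infnorm_pair)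
    obtain D1 where D1: "((\<lambda>z. 2 * fst (K z) / l z) has_derivative D1) (at x)"
       "\<forall>b. \<bar>D1 b\<bar> \<le> M1 * norm b * (1 + \<bar>2 * fst (K x) / l x\<bar>) / \<bar>l x\<bar>"
      using 1(3) xL(1) lx(3) by blast
    obtain D2 where D2: "((\<lambda>z. 2 * snd (K z) / l z) has_derivative D2) (at x)"
       "\<forall>b. \<bar>D2 b\<bar> \<le> M2 * norm b * (1 + \<bar>2 * snd (K x) / l x\<bar>) / \<bar>l x\<bar>"
      using 2(3) xL(2) lx(3) by blast
    have "(\<lambda>z. rho (K z)) = (\<lambda>z. (2 * fst (K z) / l z, 2 * snd (K z) / l z))"
      by (simp add: fun_eq_iff rho_def l_def infnorm_pair prod_eq_iff)
    then have "((\<lambda>z. rho (K z)) has_derivative (\<lambda>b. (D1 b, D2 b))) (at x)"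
      using has_derivative_Pair[OF D1(1) D2(1)] by simp
    moreover have "norm (D1 b, D2 b) \<le> (3 * (M1 + M2)) * norm b / infnorm (K x)" for b
    proof -
      have "norm (D1 b, D2 b) \<le> \<bar>D1 b\<bar> + \<bar>D2 b\<bar>"
        using norm_Pair_le[of "D1 b" "D2 b"] by simp
      also have "\<dots> \<le> M1 * norm b * (1 + 2) / \<bar>l x\<bar> + M2 * norm b * (1 + 2) / \<bar>l x\<bar>"
        using ratio 1(2) 2(2)
        by (intro add_mono order.trans[OF D1(2)[rule_format]] order.trans[OF D2(2)[rule_format]] divide_right_mono mult_left_mono) auto
      also have "\<dots> = (3 * (M1 + M2)) * norm b / infnorm (K x)"
        using lx by (simp add: field_simps)
      finally show ?thesis .
    qed
    ultimately show ?thesis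
      by (intro exI conjI allI)
  qed
  moreover have "0 \<le> 3 * (M1 + M2)"
    using 1(2) 2(2) by simp
  ultimately show ?thesis
    using hyperplanes_Un[OF 1(1) 2(1)] by (intro exI[of _ "L1 \<union> L2"] exI[of _ "3 * (M1 + M2)"]) blast
qed

lemma piecewise_affine_lens: "piecewise_affine lens"
  unfolding lens_def infnorm_pair by (intro piecewise_affine_intros)

lemma piecewise_affine_outer_map:
  "piecewise_affine (\<lambda>x. fst (outer_map x))" "piecewise_affine (\<lambda>x. snd (outer_map x))"
  unfolding outer_map_def fst_conv snd_conv by (intro piecewise_affine_intros piecewise_affine_lens)+

lemma piecewise_affine_inner_map:
  "piecewise_affine (\<lambda>x. fst (inner_map x))" "piecewise_affine (\<lambda>x. snd (inner_map x))"
  unfolding inner_map_def dipole_def fold_map_def prod.case fst_conv snd_conv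
  by (intro piecewise_affine_intros)+

lemma cav_derivative:
  shows "\<exists>L C. hyperplanes L \<and> 0 \<le> C \<and> (\<forall>x\<in>off L. infnorm x \<noteq> 2) \<and>
    (\<forall>x\<in>off L. \<forall>s\<in>sing. fst x \<noteq> fst s \<and> snd x \<noteq> snd s) \<and>
    (\<forall>x\<in>off L. \<exists>D. (cav has_derivative D) (at x) \<and> (2 < infnorm x \<longrightarrow> D = (\<lambda>b. b)) \<and>
       (infnorm x < 2 \<longrightarrow> (\<exists>s\<in>sing. \<forall>b. norm (D b) \<le> C * norm b / infnorm (x - s))))"
proof -
  obtain L1 M1 where 1: "hyperplanes L1" "0 \<le> M1"
    "\<forall>x\<in>off L1. inner_map x \<noteq> 0 \<longrightarrow> infnorm (inner_map x) \<le> 2 \<longrightarrow>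
      (\<exists>D. ((\<lambda>z. rho (inner_map z)) has_derivative D) (at x) \<and> (\<forall>b. norm (D b) \<le> M1 * norm b / infnorm (inner_map x)))"
    using rho_derivative[OF piecewise_affine_inner_map] by (elim exE conjE) (rule that)
  obtain L2 M2 where 2: "hyperplanes L2" "0 \<le> M2"
    "\<forall>x\<in>off L2. outer_map x \<noteq> 0 \<longrightarrow> infnorm (outer_map x) \<le> 2 \<longrightarrow>
      (\<exists>D. ((\<lambda>z. rho (outer_map z)) has_derivative D) (at x) \<and> (\<forall>b. norm (D b) \<le> M2 * norm b / infnorm (outer_map x)))"
    using rho_derivative[OF piecewise_affine_outer_map] by (elim exE conjE) (rule that)
  \<comment> \<open>The lines through the sides of the square, where \<open>cav\<close> passes to
    the identity, and the axis-parallel lines through the poles, where the products of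
    \<open>cut_powr\<close> do not dominate.\<close>
  define L3 :: "((real \<times> real) \<times> real) set" where
    "L3 = {((1, 0), 2), ((1, 0), -2), ((0, 1), 2), ((0, 1), -2)}
      \<union> (\<lambda>s. ((1, 0), - fst s)) ` sing \<union> (\<lambda>s. ((0, 1), - snd s)) ` sing"
  have L3: "hyperplanes L3"
    using finite_sing by (auto simp: L3_def hyperplanes_def zero_prod_def)
  let ?L = "L1 \<union> L2 \<union> L3"
  \<comment> \<open>The factors 4 and 2 come from \<open>inner_lower_A\<close>,
    \<open>inner_lower_B\<close> and from \<open>outer_lower\<close>.\<close>
  let ?C = "4 * M1 + 2 * M2"
  have "hyperplanes ?L"
    by (intro hyperplanes_Un 1 2 L3)
  moreover have "0 \<le> ?C"
    using 1(2) 2(2) by simp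
  moreover have n2: "infnorm x \<noteq> 2" if "x \<in> off ?L" for x
  proof -
    have "fst x + 2 \<noteq> 0" "fst x - 2 \<noteq> 0" "snd x + 2 \<noteq> 0" "snd x - 2 \<noteq> 0"
      using that by (auto simp: off_def L3_def inner_prod_def)
    then have "\<bar>fst x\<bar> \<noteq> 2" "\<bar>snd x\<bar> \<noteq> 2"
      by linarith+
    then show ?thesis
      by (simp add: infnorm_pair max_def)
  qed
  moreover have ns: "fst x \<noteq> fst s \<and> snd x \<noteq> snd s" if x: "x \<in> off ?L" and s: "s \<in> sing" for x s
  proof -
    have "((1, 0), - fst s) \<in> ?L" "((0, 1), - snd s) \<in> ?L"
      using s by (auto simp: L3_def)
    moreover have "fst p \<bullet> x + snd p \<noteq> 0" if "p \<in> ?L" for p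
      using x that unfolding off_def by blast
    ultimately have "fst ((1, 0) :: real \<times> real, - fst s) \<bullet> x + snd ((1, 0) :: real \<times> real, - fst s) \<noteq> 0"
      "fst ((0, 1) :: real \<times> real, - snd s) \<bullet> x + snd ((0, 1) :: real \<times> real, - snd s) \<noteq> 0"
      by blast+
    then show ?thesis
      by (simp add: inner_prod_def)
  qed
  moreover have "\<exists>D. (cav has_derivative D) (at x) \<and> (2 < infnorm x \<longrightarrow> D = (\<lambda>b. b)) \<and>
       (infnorm x < 2 \<longrightarrow> (\<exists>s\<in>sing. \<forall>b. norm (D b) \<le> ?C * norm b / infnorm (x - s)))" if x: "x \<in> off ?L" for x
  proof (cases "infnorm x < 2")
    case False
    then have x2: "2 < infnorm x"
      using n2[OF x] by simp
    moreover have "open {x :: real \<times> real. 2 < infnorm x}"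
      by (intro open_Collect_less continuous_intros)
    ultimately have "(cav has_derivative (\<lambda>b. b)) (at x)"
      by (intro has_derivative_transform_within_open[OF has_derivative_ident]) (auto simp: cav_outside)
    with x2 show ?thesis
      by auto
  next
    case lt: True
    have x_sing: "x \<notin> sing"
      using ns[OF x] by blast
    have xL: "x \<in> off L1" "x \<in> off L2"
      using x unfolding off_Un by blast+
    have "\<exists>D. (cav has_derivative D) (at x) \<and> (\<exists>s\<in>sing. \<forall>b. norm (D b) \<le> ?C * norm b / infnorm (x - s))"
    proof (cases "x \<in> inner_dom")
      case True
      have nz: "inner_map x \<noteq> 0"
        using inner_map_eq_0[of x] x_sing by (auto simp: sing_def)
      obtain D where D: "((\<lambda>z. rho (inner_map z)) has_derivative D) (at x)"
          "\<forall>b. norm (D b) \<le> M1 * norm b / infnorm (inner_map x)"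
        using 1(3) xL(1) nz dipole_bound[of x] inner_dom_pos[OF True] by blast
      have "(cav has_derivative D) (at x)"
        by (rule has_derivative_transform_within_open[OF D(1) open_inner_dom True]) (simp add: cav_inner_dom)
      moreover define s where "s = (if snd x \<le> 9/8 then ptA else ptB)"
      have s: "s \<in> sing" "infnorm (x - s) \<le> 4 * infnorm (inner_map x)"
        using inner_lower_A[of x] inner_lower_B[of x] by (simp_all add: s_def sing_def)
      have "norm (D b) \<le> ?C * norm b / infnorm (x - s)" for b
      proof -
        have pos: "0 < infnorm (x - s)"
          using s(1) x_sing by (auto simp: infnorm_pos_lt)
        have "norm (D b) \<le> M1 * norm b / (infnorm (x - s) / 4)"
          using s(2) pos 1(2) by (intro order.trans[OF D(2)[rule_format]] divide_left_mono) (auto simp: infnorm_pos_lt nz)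
        also have "\<dots> = 4 * M1 * norm b / infnorm (x - s)"
          by simp
        also have "\<dots> \<le> ?C * norm b / infnorm (x - s)"
          using pos 2(2) by (intro divide_right_mono mult_right_mono) auto
        finally show ?thesis .
      qed
      ultimately show ?thesis
        using s(1) by blast
    next
      case False
      then have True: "x \<in> outer_dom"
        using dom_cover by blast
      have nz: "outer_map x \<noteq> 0"
        using outer_map_eq_0[of x] x_sing by (auto simp: sing_def)
      obtain D where D: "((\<lambda>z. rho (outer_map z)) has_derivative D) (at x)"
          "\<forall>b. norm (D b) \<le> M2 * norm b / infnorm (outer_map x)"
        using 2(3) xL(2) nz outer_bound[OF less_imp_le[OF lt]] by blast
      have "(cav has_derivative D) (at x)"
        by (rule has_derivative_transform_within_open[OF D(1) open_outer_dom True]) (simp add: cav_outer_dom)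
      moreover have "norm (D b) \<le> ?C * norm b / infnorm (x - 0)" for b
      proof -
        have pos: "0 < infnorm x"
          using x_sing by (auto simp: infnorm_pos_lt sing_def)
        have "norm (D b) \<le> M2 * norm b / (infnorm x / 2)"
          using outer_lower[of x] pos 2(2) by (intro order.trans[OF D(2)[rule_format]] divide_left_mono) (auto simp: infnorm_pos_lt nz)
        also have "\<dots> = 2 * M2 * norm b / infnorm x"
          by simp
        also have "\<dots> \<le> ?C * norm b / infnorm x"
          using pos 1(2) by (intro divide_right_mono mult_right_mono) auto
        finally show ?thesis
          by simp
      qed
      ultimately show ?thesis
        unfolding sing_def by blast
    qed
    with lt show ?thesis
      by auto
  qed
  ultimately show ?thesis
    by (intro exI[of _ ?L] exI[of _ ?C] conjI ballI) blast+
qed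

lemma norm_cav_diff: "norm (cav x - x) \<le> 8"
proof (cases "infnorm x \<le> 2")
  case True
  have "norm (cav x) \<le> 4" "norm x \<le> 4"
    using norm_le_infnorm[of "cav x"] norm_le_infnorm[of x] infnorm_cav_le[OF True] True by linarith+
  then show ?thesis
    using norm_triangle_ineq4[of "cav x" x] by linarith
qed (simp add: cav_outside)

lemma borel_cav: "cav \<in> borel_measurable borel"
  using finite_sing continuous_on_cav by (intro borel_measurable_continuous_countable_exceptions countable_finite)

text \<open>Membership of \<open>cav\<close> in the Sobolev space of the square uses
  \<open>v\<close>, equality of traces uses \<open>w\<close> on the whole plane. Both are
  independent of \<open>p\<close>.\<close>

lemma cav_weak_partial:
  assumes b: "b \<in> Basis"
  shows "\<exists>v w. weak_partial UNIV b cav v \<and> weak_partial UNIV b (\<lambda>x. cav x - x) w \<and>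
    (\<forall>p. 1 \<le> p \<and> p < 2 \<longrightarrow> in_Lp p square v \<and> in_Lp p UNIV w)"
proof -
  obtain L C where L: "hyperplanes L" and C: "0 \<le> C" and n2: "\<forall>x\<in>off L. infnorm x \<noteq> 2"
    and ns: "\<forall>x\<in>off L. \<forall>s\<in>sing. fst x \<noteq> fst s \<and> snd x \<noteq> snd s"
    and der: "\<forall>x\<in>off L. \<exists>D. (cav has_derivative D) (at x) \<and> (2 < infnorm x \<longrightarrow> D = (\<lambda>b. b)) \<and>
       (infnorm x < 2 \<longrightarrow> (\<exists>s\<in>sing. \<forall>b. norm (D b) \<le> C * norm b / infnorm (x - s)))"
    using cav_derivative by (elim exE conjE) (rule that)
  obtain D where D: "\<forall>x\<in>off L. (cav has_derivative D x) (at x) \<and> (2 < infnorm x \<longrightarrow> D x = (\<lambda>b. b)) \<and>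
       (infnorm x < 2 \<longrightarrow> (\<exists>s\<in>sing. \<forall>b. norm (D x b) \<le> C * norm b / infnorm (x - s)))"
    using bchoice[OF der] by (elim exE) (rule that)
  define v where "v x = (if x \<in> off L then D x b else 0)" for x
  define w where "w x = (if x \<in> off L then D x b - b else 0)" for x
  have G: "off L \<in> sets borel"
    using open_off[OF L] by (rule borel_open)
  have b1: "norm b = 1" "b \<noteq> 0"
    using b by auto
  have dcav: "(cav has_derivative D x) (at x)" "((\<lambda>z. cav z - z) has_derivative (\<lambda>b. D x b - b)) (at x)"
    if "x \<in> off L" for x
    using D that by (auto intro!: has_derivative_diff has_derivative_ident)
  have v_meas: "v \<in> borel_measurable borel"
    unfolding v_def by (intro borel_measurable_directional_derivative[OF borel_cav G b1(2)] dcav)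
  have w_meas: "w \<in> borel_measurable borel"
    unfolding w_def
    by (rule borel_measurable_directional_derivative[OF _ G b1(2), of "\<lambda>z. cav z - z" "\<lambda>x b. D x b - b"])
      (auto intro!: borel_measurable_diff borel_cav dcav)
  have sing2: "infnorm s \<le> 2" if "s \<in> sing" for s
    using that by (auto simp: sing_def ptA_def ptB_def infnorm_pair)
  have sing_bound: "\<exists>s\<in>sing. fst x \<noteq> fst s \<and> snd x \<noteq> snd s \<and> infnorm s \<le> 2 \<and> norm (v x) \<le> (C + 4) / infnorm (x - s)
      \<and> norm (w x) \<le> (C + 4) / infnorm (x - s)"
    if x: "infnorm x \<le> 2" "x \<in> off L" for x
  proof -
    have "infnorm x < 2"
      using n2 x by (auto simp: order_less_le)
    then obtain s where s: "s \<in> sing" "norm (D x b) \<le> C * norm b / infnorm (x - s)"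
      using D x(2) by blast
    have ne: "fst x \<noteq> fst s \<and> snd x \<noteq> snd s"
      using ns x(2) s(1) by blast
    then have pos: "0 < infnorm (x - s)"
      by (auto simp: infnorm_pos_lt)
    have "infnorm (x - s) \<le> 4"
      using infnorm_triangle[of x "- s"] x(1) sing2[OF s(1)] by (simp add: infnorm_neg)
    \<comment> \<open>The constant 1 from subtracting \<open>b\<close> is absorbed into the singular
      bound.\<close>
    then have "1 \<le> 4 / infnorm (x - s)"
      using pos by simp
    moreover have "norm (D x b - b) \<le> C / infnorm (x - s) + 1"
      using s(2) b1(1) norm_triangle_ineq4[of "D x b" b] by simp
    ultimately have "norm (v x) \<le> (C + 4) / infnorm (x - s)" "norm (w x) \<le> (C + 4) / infnorm (x - s)"
      using s(2) b1(1) x(2) by (simp_all add: v_def w_def add_divide_distrib)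
    then show ?thesis
      using s(1) ne sing2 by blast
  qed
  have w_out: "w x = 0" if "2 < infnorm x" for x
    using D that by (auto simp: w_def)
  have w_int: "integrable lborel (\<lambda>x. norm (w x) powr p)" if "1 \<le> p" "p < 2" for p
  proof (rule integrable_powr_singular[OF that w_meas finite_sing w_out, where C = "C + 4"])
    show "\<exists>s\<in>sing. fst x \<noteq> fst s \<and> snd x \<noteq> snd s \<and> infnorm s \<le> 2 \<and> norm (w x) \<le> (C + 4) / infnorm (x - s)"
      if "infnorm x \<le> 2" "w x \<noteq> 0" for x
    proof -
      have "x \<in> off L"
        using that(2) by (auto simp: w_def split: if_splits)
      from sing_bound[OF that(1) this] show ?thesis
        by blast
    qed
  qed
  \<comment> \<open>Outside the square \<open>v\<close> is \<open>b\<close> almost everywhere, hence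
    not integrable on the plane; the truncation is.\<close>
  define v' where "v' x = (if infnorm x \<le> 2 then v x else 0)" for x
  have v'_meas: "v' \<in> borel_measurable borel"
    unfolding v'_def using v_meas
    by (intro measurable_If borel_measurable_const) (auto intro!: borel_closed closed_Collect_le continuous_intros simp: pred_def)
  have v'_int: "integrable lborel (\<lambda>x. norm (v' x) powr p)" if "1 \<le> p" "p < 2" for p
  proof (rule integrable_powr_singular[OF that v'_meas finite_sing, where C = "C + 4"])
    show "v' x = 0" if "2 < infnorm x" for x
      using that by (simp add: v'_def)
    show "\<exists>s\<in>sing. fst x \<noteq> fst s \<and> snd x \<noteq> snd s \<and> infnorm s \<le> 2 \<and> norm (v' x) \<le> (C + 4) / infnorm (x - s)"
      if "infnorm x \<le> 2" "v' x \<noteq> 0" for x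
    proof -
      have "x \<in> off L"
        using that(2) by (auto simp: v_def v'_def split: if_splits)
      from sing_bound[OF that(1) this] that(1) show ?thesis
        unfolding v'_def by auto
    qed
  qed
  have w1: "integrable lborel w"
    using w_int[of 1] w_meas by (intro integrable_norm_cancel[of lborel w]) auto
  have v_set: "set_integrable lborel (cbox a c) v" for a c
    unfolding set_integrable_def
  proof (rule Bochner_Integration.integrable_bound)
    \<comment> \<open>On \<open>off L\<close> the functions \<open>v\<close> and \<open>w\<close>
      differ by the unit vector \<open>b\<close>, which is integrable over a box.\<close>
    show "integrable lborel (\<lambda>x. norm (w x) + indicator (cbox a c) x * 1)"
      by (intro Bochner_Integration.integrable_add integrable_norm w1 integrable_mult_left integrable_real_indicator)
        (auto simp: emeasure_lborel_cbox_eq)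
    have "norm (v x) \<le> norm (w x) + 1" for x
      using b1(1) norm_triangle_ineq2[of "D x b" b] by (simp add: v_def w_def)
    then show "AE x in lborel. norm (indicator (cbox a c) x *\<^sub>R v x) \<le> norm (norm (w x) + indicator (cbox a c) x * 1)"
      by (intro AE_I2) (simp add: indicator_def)
  qed (use v_meas in measurable)
  have w_set: "set_integrable lborel (cbox a c) w" for a c
    unfolding set_integrable_def by (intro integrable_mult_indicator w1) simp
  have "weak_partial UNIV b cav v"
  proof (rule weak_partial_lines[OF L finite_sing b continuous_on_cav _ v_meas v_set])
    show "\<exists>C. \<forall>x. norm x \<le> B \<longrightarrow> norm (cav x) \<le> C" for B
      using norm_cav_diff norm_triangle_sub[of "cav _"] by (intro exI[of _ "B + 8"]) (smt (verit))
    show "((\<lambda>t. cav (x + t *\<^sub>R b)) has_vector_derivative v x) (at 0)" if "x \<in> off L" for x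
      using has_vector_derivative_line[OF dcav(1)[OF that], of b] that by (simp add: v_def)
  qed
  moreover have "weak_partial UNIV b (\<lambda>x. cav x - x) w"
  proof (rule weak_partial_lines[OF L finite_sing b _ _ w_meas w_set])
    show "continuous_on (- sing) (\<lambda>x. cav x - x)"
      by (intro continuous_intros continuous_on_cav)
    show "\<exists>C. \<forall>x. norm x \<le> B \<longrightarrow> norm (cav x - x) \<le> C" for B
      using norm_cav_diff by blast
    show "((\<lambda>t. cav (x + t *\<^sub>R b) - (x + t *\<^sub>R b)) has_vector_derivative w x) (at 0)" if "x \<in> off L" for x
      using has_vector_derivative_line[OF dcav(2)[OF that], of b] that by (simp add: w_def)
  qed
  moreover have "in_Lp p square v" if "1 \<le> p" "p < 2" for p
  proof (rule in_LpI[OF v_meas square_borel])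
    have "integrable lborel (\<lambda>x. indicator square x *\<^sub>R (norm (v' x) powr p))"
      using square_borel by (intro integrable_mult_indicator v'_int that) simp
    moreover have "indicator square x *\<^sub>R (norm (v' x) powr p) = indicator square x * norm (v x) powr p" for x
      by (auto simp: indicator_def v'_def square_infnorm)
    ultimately show "integrable lborel (\<lambda>x. indicator square x * norm (v x) powr p)"
      by (simp only:)
  qed
  moreover have "in_Lp p UNIV w" if "1 \<le> p" "p < 2" for p
    using w_int[OF that] by (intro in_LpI[OF w_meas]) auto
  ultimately show ?thesis
    by (intro exI[of _ v] exI[of _ w]) auto
qed

lemma W1p_cav:
  assumes p: "1 \<le> p" "p < 2"
  shows "W1p p square cav" "same_trace p square cav (\<lambda>x. x)"
proof -
  have "square \<in> sets lebesgue"
    using square_borel by simp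
  moreover have "in_Lp p square cav"
  proof (rule in_LpI[OF borel_cav square_borel], rule bounded_powr_integrable[OF _ borel_cav _ square_borel, of _ 12])
    show "norm (cav x) \<le> 12" if "infnorm x \<le> 2" for x
      using norm_le_infnorm[of "cav x"] infnorm_cav_le[OF that] by linarith
    show "norm (cav x) powr p = 0" if "x \<in> square" "2 < infnorm x" for x
      using that unfolding square_infnorm by simp
  qed (use p in simp)
  ultimately show "W1p p square cav"
    unfolding W1p_def using cav_weak_partial weak_partial_subset p by blast
  \<comment> \<open>The difference already vanishes outside the open square, so its extension by
    zero is the difference itself.\<close>
  have eq: "(\<lambda>x. if x \<in> square then cav x - x else 0) = (\<lambda>x. cav x - x)"
    unfolding square_infnorm by (auto simp: fun_eq_iff cav_outside)
  have "in_Lp p UNIV (\<lambda>x. cav x - x)"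
  proof (rule in_LpI, rule borel_measurable_diff[OF borel_cav], simp, simp,
      rule bounded_powr_integrable[OF _ borel_measurable_diff[OF borel_cav], of _ _ 8])
    show "norm (cav x - x) powr p = 0" if "2 < infnorm x" for x
      using that by (simp add: cav_outside)
  qed (use p norm_cav_diff in auto)
  then show "same_trace p square cav (\<lambda>x. x)"
    unfolding same_trace_def eq W1p_def using cav_weak_partial p by blast
qed

text \<open>The value \<open>t = 0\<close> is included, which gives the cubes \<open>Q\<close> and
  \<open>Q\<^sub>1\<close> themselves. The two topological images are told apart by the
  origin.\<close>

lemma cav_cubes:
  assumes t: "0 \<le> t" "t < 1/8"
  shows "let Q = {-1 - t..1 + t} \<times> {-1 - t..1 + t};
           Q\<^sub>1 = {-1/2 + t..0 - t} \<times> {1/2 + t..1 - t} in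
       continuous_on (frontier Q) cav \<and> continuous_on (frontier Q\<^sub>1) cav \<and>
       Q\<^sub>1 \<subseteq> Q \<and>
       cav ` (Q\<^sub>1 - sing) \<subseteq> cav ` frontier Q \<and>
       \<not> im_T cav Q\<^sub>1 \<subseteq> im_T cav Q \<and>
       (\<forall>y \<in> im_T cav Q\<^sub>1. brouwer_deg cav Q\<^sub>1 y = -1)"
proof -
  have Q: "{-1 - t..1 + t} \<times> {-1 - t..1 + t} = large_cube t"
    by (simp add: large_cube_def cube_def)
  have Q1: "{-1/2 + t..0 - t} \<times> {1/2 + t..1 - t} = pole_cube t"
    by (simp add: pole_cube_def cube_def ptA_def)
  have Q1_le: "infnorm x \<le> 2" if "x \<in> cube ptA (1/4 - t)" for x
    using pole_cube_lens(4)[OF t] that unfolding pole_cube_def by (simp add: less_imp_le)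
  have deg: "brouwer_deg cav (pole_cube t) y = -1" if "y \<in> im_T cav (pole_cube t)" for y
  proof (rule deg_pole_cube[OF t])
    show "infnorm y < 2"
      using t that Q1_le frontier_avoids_sing(2)[OF t] unfolding pole_cube_def by (intro im_T_cav[of "1/4 - t" ptA]) auto
  qed
  have "0 \<notin> cav ` frontier (pole_cube t)"
  proof
    assume "0 \<in> cav ` frontier (pole_cube t)"
    then obtain x where x: "x \<in> frontier (pole_cube t)" "cav x = 0"
      by auto
    then have "x \<in> pole_cube t"
      using frontier_subset_closed[OF closed_cube] unfolding pole_cube_def by blast
    then have "infnorm (cav x) = 2"
      using x(1) frontier_avoids_sing(2)[OF t] Q1_le unfolding pole_cube_def by (intro infnorm_cav) auto
    with x(2) show False
      by (simp add: infnorm_0)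
  qed
  then have "0 \<in> im_T cav (pole_cube t)"
    using deg_pole_cube[OF t, of 0] by (simp add: im_T_def infnorm_0)
  moreover have "0 \<notin> im_T cav (large_cube t)"
    using deg_large_cube[OF t] by (simp add: im_T_def)
  ultimately have "\<not> im_T cav (pole_cube t) \<subseteq> im_T cav (large_cube t)"
    by blast
  then show ?thesis
    unfolding Let_def Q Q1 using continuous_frontier[OF t] pole_cube_subset[OF t] cav_pole_cube_subset[OF t] deg by blast
qed

theorem lemma3p12:
  shows "\<exists>(f :: real \<times> real \<Rightarrow> real \<times> real) S.
    finite S \<and>
    f ` ({-2..2} \<times> {-2..2}) \<subseteq> {-2..2} \<times> {-2..2} \<and>
    (\<forall>x \<in> frontier ({-2..2} \<times> {-2..2}). f x = x) \<and>
    (\<forall>p. 1 \<le> p \<and> p < 2 \<longrightarrow>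
       W1p p ({-2<..<2} \<times> {-2<..<2}) f \<and>
       same_trace p ({-2<..<2} \<times> {-2<..<2}) f (\<lambda>x. x)) \<and>
    INV_cubes ({-2<..<2} \<times> {-2<..<2}) f \<and>
    (let Q = {-1..1} \<times> {-1..1}; Q\<^sub>1 = {-1/2..0} \<times> {1/2..1} in
       continuous_on (frontier Q) f \<and> continuous_on (frontier Q\<^sub>1) f \<and>
       Q\<^sub>1 \<subseteq> Q \<and>
       f ` (Q\<^sub>1 - S) \<subseteq> f ` frontier Q \<and>
       \<not> im_T f Q\<^sub>1 \<subseteq> im_T f Q \<and>
       (\<forall>y \<in> im_T f Q\<^sub>1. brouwer_deg f Q\<^sub>1 y = -1)) \<and>
    (\<exists>t\<^sub>0>0. \<forall>t. 0 < t \<and> t < t\<^sub>0 \<longrightarrow>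
      (let Q = {-1 - t..1 + t} \<times> {-1 - t..1 + t};
           Q\<^sub>1 = {-1/2 + t..0 - t} \<times> {1/2 + t..1 - t} in
       continuous_on (frontier Q) f \<and> continuous_on (frontier Q\<^sub>1) f \<and>
       Q\<^sub>1 \<subseteq> Q \<and>
       f ` (Q\<^sub>1 - S) \<subseteq> f ` frontier Q \<and>
       \<not> im_T f Q\<^sub>1 \<subseteq> im_T f Q \<and>
       (\<forall>y \<in> im_T f Q\<^sub>1. brouwer_deg f Q\<^sub>1 y = -1)))"
proof (rule exI[of _ cav], rule exI[of _ sing], intro conjI)
  have sq: "{-2..2} \<times> {-2..2} = cube 0 2"
    by (simp add: cube_def)
  show "finite sing"
    by (rule finite_sing)
  show "cav ` ({-2..2} \<times> {-2..2}) \<subseteq> {-2..2} \<times> {-2..2}"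
    unfolding sq cube_infnorm by (auto simp: infnorm_cav_le)
  show "\<forall>x \<in> frontier ({-2..2} \<times> {-2..2}). cav x = x"
    unfolding sq frontier_cube by (auto simp: cav_outside)
  show "\<forall>p. 1 \<le> p \<and> p < 2 \<longrightarrow> W1p p square cav \<and> same_trace p square cav (\<lambda>x. x)"
    using W1p_cav by blast
  show "INV_cubes square cav"
    by (rule INV_cubes_cav)
  show "let Q = {-1..1} \<times> {-1..1}; Q\<^sub>1 = {-1/2..0} \<times> {1/2..1} in
       continuous_on (frontier Q) cav \<and> continuous_on (frontier Q\<^sub>1) cav \<and>
       Q\<^sub>1 \<subseteq> Q \<and>
       cav ` (Q\<^sub>1 - sing) \<subseteq> cav ` frontier Q \<and>
       \<not> im_T cav Q\<^sub>1 \<subseteq> im_T cav Q \<and>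
       (\<forall>y \<in> im_T cav Q\<^sub>1. brouwer_deg cav Q\<^sub>1 y = -1)"
    using cav_cubes[of 0] by simp
  show "\<exists>t\<^sub>0>0. \<forall>t. 0 < t \<and> t < t\<^sub>0 \<longrightarrow>
      (let Q = {-1 - t..1 + t} \<times> {-1 - t..1 + t};
           Q\<^sub>1 = {-1/2 + t..0 - t} \<times> {1/2 + t..1 - t} in
       continuous_on (frontier Q) cav \<and> continuous_on (frontier Q\<^sub>1) cav \<and>
       Q\<^sub>1 \<subseteq> Q \<and>
       cav ` (Q\<^sub>1 - sing) \<subseteq> cav ` frontier Q \<and>
       \<not> im_T cav Q\<^sub>1 \<subseteq> im_T cav Q \<and>
       (\<forall>y \<in> im_T cav Q\<^sub>1. brouwer_deg cav Q\<^sub>1 y = -1))"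
    using cav_cubes by (intro exI[of _ "1/8"] conjI allI impI) (simp, elim conjE, simp only: less_imp_le)
qed

end
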